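(* Let $H$ be a commutative Krull monoid with class group $G$ such that $\mathsf D(G) \ge 3$, and suppose that every class contains a prime divisor. (1) $\mathsf{Ta}(C_3) = \mathsf{Ta}(C_2 \oplus C_2) = \{3\}$. If $G$ is finite and either $\mathsf D(G) \ge 4$ or there is a nonzero class containing at least two distinct prime divisors, then $[2, \mathsf D(G)] \subset \mathsf{Ta}(H)$. (2) If every class contains at least $\mathsf D(G) + 1$ prime divisors, then $\mathsf{Ta}(H) = [2, \mathsf t(H)]$. (3) If $G$ is infinite, then $\mathsf{Ta}(H) = \mathbb N_{\ge 2}$.
   Context: $[a,b] = \{x \in \mathbb Z \mid a \le x \le b\}$ (so $[2,\infty] = \mathbb N_{\ge 2}$); $\subset$ allows equality; $C_n$ is a cyclic group of order $n$. Monoids are cancellative with identity. For a commutative monoid $H$, $H^{\times}$ is the unit group, $H_{\mathrm{red}} = H/H^{\times}$, $\mathsf q(\cdot)$ denotes quotient groups, and $\mathcal A(\cdot)$ the set of atoms (irreducible elements). Krull monoids: for a set $P$, $\mathcal F(P)$ is the free abelian monoid with basis $P$. A homomorphism $\varphi \colon H \to F=\mathcal F(P)$ is a divisor theory if $\varphi(a) \mid \varphi(b)$ implies $a \mid b$ for all $a,b\in H$, and every $\alpha \in F$ is of the form $\alpha = \gcd(\varphi(a_1), \dots, \varphi(a_m))$ with $a_1, \dots, a_m \in H$. A commutative monoid $H$ is a Krull monoid if it has a divisor theory; then there is a free abelian monoid $F = \mathcal F(P)$ such that the inclusion $H_{\mathrm{red}} \hookrightarrow F$ is a divisor theory, the class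 group of $H$ is $\mathsf q(F)/\mathsf q(H_{\mathrm{red}})$ (written additively), the elements of $P$ are the prime divisors, and the class containing $p \in P$ is $[p] = p\,\mathsf q(H_{\mathrm{red}})$. Zero-sum sequences: for an additive abelian group $G$, $\mathcal B(G)$ is the monoid of all $S = g_1 \cdots g_\ell \in \mathcal F(G)$ with $g_1 + \dots + g_\ell = 0$; $|S| = \ell$; $\mathsf D(G) \in \mathbb N \cup \{\infty\}$ is the supremum of $|U|$ over all atoms $U$ of $\mathcal B(G)$ (it is infinite if $G$ is infinite). Tame degrees: let $H$ be a commutative atomic monoid in which every element has only finitely many factorization lengths. $\mathsf Z(H) = \mathcal F(\mathcal A(H_{\mathrm{red}}))$ is the factorization monoid, $\pi \colon \mathsf Z(H) \to H_{\mathrm{red}}$ the canonical homomorphism, $\mathsf Z(a) = \pi^{-1}(aH^{\times})$. For $z, z' \in \mathsf Z(H)$ write $z = xy$, $z' = xy'$ with $x = \gcd(z,z')$ in $\mathsf Z(H)$; then $\mathsf d(z,z') = \max\{|y|, |y'|\}$, where $|\cdot|$ is the length in the free abelian monoid. For $a \in H$ and $u \in \mathcal A(H_{\mathrm{red}})$, the tame degree $\mathsf t(a,u)$ is the smallest $N \in \mathbb N_0\cup\{\infty\}$ such that: if $\mathsf Z(a) \cap u\mathsf Z(H) \ne \emptyset$ and $z \in \mathsf Z(a)$, then there is $z' \in \mathsf Z(a) \cap u\mathsf Z(H)$ with $\mathsf d(z,z') \le N$ (so $\mathsf t(a,u) = 0$ if $\mathsf Z(a) \cap u\mathsf Z(H)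 = \emptyset$). Then $\mathsf{Ta}(H) = \{\mathsf t(a,u) \mid a \in H,\ u \in \mathcal A(H_{\mathrm{red}}),\ \mathsf t(a,u) > 0\}$ and $\mathsf t(H) = \sup \mathsf{Ta}(H)$ ($\sup \emptyset = 0$). For an abelian group $G$, $\mathsf{Ta}(G) := \mathsf{Ta}(\mathcal B(G))$. *)

theory Defs
  imports
    "HOL-Algebra.Algebra"
    "HOL-Library.Multiset"
    "HOL-Library.Extended_Nat"
begin

section \<open>Commutative monoids\<close>

definition atoms :: "('a, 'm) monoid_scheme \<Rightarrow> 'a set" where
  "atoms M = {u \<in> carrier M. irreducible M u}"

text \<open>
  The library's \<open>Mod\<close> only uses the multiplication of the ambient structure, so it also makes
  sense for the submonoid of units of a commutative monoid; the elements are the sets \<open>a H\<^sup>\<times>\<close>.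
\<close>

definition reduced_monoid :: "('a, 'm) monoid_scheme \<Rightarrow> 'a set monoid" where
  "reduced_monoid H = H Mod (Units H)"

definition free_comm_monoid :: "'p set \<Rightarrow> 'p multiset monoid" where
  "free_comm_monoid P = \<lparr>carrier = {S. set_mset S \<subseteq> P}, monoid.mult = (+), one = {#}\<rparr>"

definition mset_prod :: "('a, 'm) monoid_scheme \<Rightarrow> 'a multiset \<Rightarrow> 'a" where
  "mset_prod M S = (\<Otimes>\<^bsub>M\<^esub>g\<in>set_mset S. g [^]\<^bsub>M\<^esub> count S g)"


section \<open>Divisor theories and class groups\<close>

definition is_gcd :: "('a, 'm) monoid_scheme \<Rightarrow> 'a \<Rightarrow> 'a set \<Rightarrow> bool" where
  "is_gcd M d A \<longleftrightarrow> d \<in> carrier M \<and> (\<forall>x\<in>A. d divides\<^bsub>M\<^esub> x) \<and>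
     (\<forall>c\<in>carrier M. (\<forall>x\<in>A. c divides\<^bsub>M\<^esub> x) \<longrightarrow> c divides\<^bsub>M\<^esub> d)"

definition divisor_theory ::
    "('a, 'm) monoid_scheme \<Rightarrow> 'p set \<Rightarrow> ('a \<Rightarrow> 'p multiset) \<Rightarrow> bool" where
  "divisor_theory H P \<phi> \<longleftrightarrow>
     \<phi> \<in> hom H (free_comm_monoid P) \<and>
     (\<forall>a\<in>carrier H. \<forall>b\<in>carrier H.
        \<phi> a divides\<^bsub>free_comm_monoid P\<^esub> \<phi> b \<longrightarrow> a divides\<^bsub>H\<^esub> b) \<and>
     (\<forall>\<alpha>\<in>carrier (free_comm_monoid P). \<exists>A. finite A \<and> A \<noteq> {} \<and> A \<subseteq> carrier H \<and>
        is_gcd (free_comm_monoid P) \<alpha> (\<phi> ` A))"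

text \<open>
  A Krull monoid together with a divisor theory. HOL cannot quantify existentially over the type
  of prime divisors, so the divisor theory is carried along explicitly; it is unique up to a
  unique isomorphism.
\<close>

definition krull_monoid_with ::
    "('a, 'm) monoid_scheme \<Rightarrow> 'p set \<Rightarrow> ('a \<Rightarrow> 'p multiset) \<Rightarrow> bool" where
  "krull_monoid_with H P \<phi> \<longleftrightarrow> comm_monoid_cancel H \<and> divisor_theory H P \<phi>"

text \<open>
  The quotient group of the free abelian monoid on \<open>P\<close> is the free abelian group on \<open>P\<close>;
  \<open>frag_of_mset\<close> is the canonical embedding of the former into the latter.
\<close>

definition frag_of_mset :: "'p multiset \<Rightarrow> ('p \<Rightarrow>\<^sub>0 int)" where
  "frag_of_mset S = (\<Sum>p\<in>#S. frag_of p)"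

definition principal_divisors ::
    "('a, 'm) monoid_scheme \<Rightarrow> ('a \<Rightarrow> 'p multiset) \<Rightarrow> ('p \<Rightarrow>\<^sub>0 int) set" where
  "principal_divisors H \<phi> =
     {frag_of_mset (\<phi> a) - frag_of_mset (\<phi> b) | a b. a \<in> carrier H \<and> b \<in> carrier H}"

definition class_group ::
    "('a, 'm) monoid_scheme \<Rightarrow> 'p set \<Rightarrow> ('a \<Rightarrow> 'p multiset) \<Rightarrow> ('p \<Rightarrow>\<^sub>0 int) set monoid" where
  "class_group H P \<phi> = free_Abelian_group P Mod principal_divisors H \<phi>"

definition divisor_class ::
    "('a, 'm) monoid_scheme \<Rightarrow> 'p set \<Rightarrow> ('a \<Rightarrow> 'p multiset) \<Rightarrow> 'p \<Rightarrow> ('p \<Rightarrow>\<^sub>0 int) set" where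
  "divisor_class H P \<phi> p = principal_divisors H \<phi> #>\<^bsub>free_Abelian_group P\<^esub> frag_of p"

definition primes_in_class ::
    "('a, 'm) monoid_scheme \<Rightarrow> 'p set \<Rightarrow> ('a \<Rightarrow> 'p multiset) \<Rightarrow> ('p \<Rightarrow>\<^sub>0 int) set \<Rightarrow> 'p set" where
  "primes_in_class H P \<phi> C = {p \<in> P. divisor_class H P \<phi> p = C}"


section \<open>Zero-sum sequences\<close>

text \<open>
  Abelian groups are written multiplicatively, as usual for \<open>comm_group\<close>, so a zero-sum sequence
  is a multiset with product \<open>\<one>\<close>.
\<close>

definition zero_sum_monoid :: "('g, 'm) monoid_scheme \<Rightarrow> 'g multiset monoid" where
  "zero_sum_monoid G =
     (free_comm_monoid (carrier G)) \<lparr>carrier := {S. set_mset S \<subseteq> carrier G \<and> mset_prod G S = \<one>\<^bsub>G\<^esub>}\<rparr>"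

definition davenport :: "('g, 'm) monoid_scheme \<Rightarrow> enat" where
  "davenport G = (SUP U\<in>atoms (zero_sum_monoid G). enat (size U))"


section \<open>Factorizations and tame degrees\<close>

definition factorization_monoid :: "('a, 'm) monoid_scheme \<Rightarrow> 'a set multiset monoid" where
  "factorization_monoid H = free_comm_monoid (atoms (reduced_monoid H))"

definition factorizations :: "('a, 'm) monoid_scheme \<Rightarrow> 'a \<Rightarrow> 'a set multiset set" where
  "factorizations H a = {z \<in> carrier (factorization_monoid H).
     mset_prod (reduced_monoid H) z = Units H #>\<^bsub>H\<^esub> a}"

text \<open>The greatest common divisor in a free abelian monoid is the multiset intersection.\<close>

definition fact_dist :: "'b multiset \<Rightarrow> 'b multiset \<Rightarrow> nat" where
  "fact_dist z z' = max (size (z - (z \<inter># z'))) (size (z' - (z \<inter># z')))"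

definition factorizations_with ::
    "('a, 'm) monoid_scheme \<Rightarrow> 'a \<Rightarrow> 'a set \<Rightarrow> 'a set multiset set" where
  "factorizations_with H a u =
     factorizations H a \<inter> {add_mset u y | y. y \<in> carrier (factorization_monoid H)}"

definition tame_degree_at :: "('a, 'm) monoid_scheme \<Rightarrow> 'a \<Rightarrow> 'a set \<Rightarrow> enat" where
  "tame_degree_at H a u = (LEAST N :: enat. \<forall>z\<in>factorizations H a.
     factorizations_with H a u \<noteq> {} \<longrightarrow>
     (\<exists>z'\<in>factorizations_with H a u. enat (fact_dist z z') \<le> N))"

definition Ta :: "('a, 'm) monoid_scheme \<Rightarrow> enat set" where
  "Ta H = {tame_degree_at H a u | a u.
     a \<in> carrier H \<and> u \<in> atoms (reduced_monoid H) \<and> tame_degree_at H a u > 0}"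

text \<open>In \<open>enat\<close>, the supremum of the empty set is 0.\<close>

definition tame_degree :: "('a, 'm) monoid_scheme \<Rightarrow> enat" where
  "tame_degree H = Sup (Ta H)"

text \<open>The set of integers from \<open>a\<close> to \<open>b\<close>; it omits \<open>\<infinity>\<close> even if \<open>b = \<infinity>\<close>.\<close>

definition int_interval :: "nat \<Rightarrow> enat \<Rightarrow> enat set" where
  "int_interval a b = enat ` {n. a \<le> n \<and> enat n \<le> b}"

end

theory Submission
  imports Defs
begin

text \<open>
  A divisor theory turns the question into one about multisets. By it, \<open>H\<close> modulo its units is
  the monoid of those multisets \<open>S\<close> of primes whose classes multiply to \<open>\<one>\<close> in the class group
  \<open>G\<close>, and this monoid of multisets is saturated: if \<open>x\<close> and \<open>x + y\<close> lie in it, then so does \<open>y\<close>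
  (\<open>divisor_hom.Ta_eq\<close>, \<open>krull.ZS_eq_image\<close>). In such a monoid a factorization of \<open>a\<close> that
  contains the atom \<open>u\<close> is the same as \<open>u\<close> together with a factorization of \<open>a - u\<close>. Distances
  of distinct factorizations are at least 2 and at most the number of primes in \<open>a\<close>, so every
  positive tame degree is a finite number that is at least 2.

  Values up to \<open>D(G)\<close>. Merging two primes of an atom into one prime of the product class gives
  an atom again, so atoms exist in every size up to \<open>D(G)\<close>. An atom \<open>U\<close> of size \<open>n \<ge> 3\<close> gives
  the value \<open>n\<close>: replace each of its primes by one of the inverse class to obtain \<open>V\<close>; then
  \<open>U + V\<close> has only one factorization containing \<open>U\<close>, namely \<open>U\<close> and \<open>V\<close>, and its factorization
  into \<open>n\<close> pairs is at distance \<open>n\<close> from it, while no factorization has more than \<open>n\<close> atoms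
  (\<open>size_atom_in_Ta\<close>). The value 2 comes from elements all of whose factorizations have at most
  two atoms; an atom of size at least 4 yields one (\<open>two_in_Ta_of_large_atom\<close>), and so do two
  distinct primes in a nontrivial class (\<open>two_in_Ta_of_two_primes\<close>). This gives the interval up
  to \<open>D(G)\<close>, and all values if \<open>G\<close> is infinite, since then arbitrarily long sequences without a
  zero-sum subsequence can be chosen greedily, so that \<open>D(G) = \<infinity>\<close>.

  Values above \<open>D(G)\<close>, when every class contains many primes. Let \<open>M > D(G)\<close> be at most some
  tame degree, and take \<open>a\<close> of smallest size with \<open>t(a, u) \<ge> M\<close> for some \<open>u\<close>. If the degree were
  larger than \<open>M\<close>, a factorization \<open>z\<close> attaining it would have no proper part whose product is
  divisible by \<open>u\<close>, by minimality of \<open>a\<close>; hence it has at most \<open>|u| \<le> D(G)\<close> atoms, and the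
  distance is governed by the smallest length of a factorization of \<open>a - u\<close>. Merging two primes
  of \<open>a - u\<close> that lie in one atom of \<open>z\<close> makes \<open>a\<close> smaller and lowers this length by at most 1.
  The result still has tame degree at least \<open>M\<close> at \<open>u\<close>, provided that the merged prime does not
  occur in \<open>u\<close>; a class with more than \<open>D(G)\<close> primes contains such a prime. This contradicts the
  choice of \<open>a\<close> (\<open>Ta_above_davenport\<close>).

  For the cyclic group of order 3 and the elementary group of order 4 the atoms can be listed,
  and all relations between them follow from one, which trades three atoms for two
  (\<open>Ta_of_single_trade\<close>).
\<close>

section \<open>Multisets and distances\<close>

text \<open>
  Each element of \<open>u\<close> that is not yet covered calls for at most one further summand.
\<close>

lemma subset_mset_sum_cover:
  assumes "u \<subseteq># \<Sum>\<^sub># z"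
  obtains y where "y \<subseteq># z" "u \<subseteq># \<Sum>\<^sub># y" "size y \<le> size u"
proof -
  have "\<exists>y. y \<subseteq># z \<and> u \<subseteq># \<Sum>\<^sub># y \<and> size y \<le> size u"
    using assms
  proof (induction u)
    case empty
    show ?case by (intro exI[of _ "{#}"]) simp
  next
    case (add p u)
    from add.prems have "u \<subseteq># \<Sum>\<^sub># z"
      by (meson mset_subset_eq_insertD subset_mset.less_imp_le)
    with add.IH obtain y where y: "y \<subseteq># z" "u \<subseteq># \<Sum>\<^sub># y" "size y \<le> size u" by blast
    show ?case
    proof (cases "add_mset p u \<subseteq># \<Sum>\<^sub># y")
      case True
      with y show ?thesis by (intro exI[of _ y]) simp
    next
      case False
      have z: "\<Sum>\<^sub># z = \<Sum>\<^sub># y + \<Sum>\<^sub># (z - y)"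
        using y(1) by (metis subset_mset.add_diff_inverse sum_mset.union)
      have "count (\<Sum>\<^sub># y) p \<le> count u p"
      proof (rule ccontr)
        assume "\<not> ?thesis"
        then have "add_mset p u \<subseteq># \<Sum>\<^sub># y"
          using y(2) by (auto simp: subseteq_mset_def Suc_le_eq)
        with False show False by simp
      qed
      moreover have "count (add_mset p u) p \<le> count (\<Sum>\<^sub># z) p"
        using add.prems by (rule mset_subset_eq_count)
      ultimately have "p \<in># \<Sum>\<^sub># (z - y)"
        unfolding z count_union
        by (metis add.right_neutral count_add_mset not_in_iff not_less_eq_eq order_trans)
      then obtain v where v: "v \<in># z - y" "p \<in># v" by (auto simp: in_Union_mset_iff)
      have "add_mset v y \<subseteq># z"
        using v(1) y(1)
        by (metis mset_subset_eq_single subset_mset.le_diff_conv2 add_mset_add_single add.commute)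
      moreover have "add_mset p u \<subseteq># \<Sum>\<^sub># (add_mset v y)"
        using subset_mset.add_mono[of "{#p#}" v u "\<Sum>\<^sub># y"] v(2) y(2) by simp
      ultimately show ?thesis using y(3) by (intro exI[of _ "add_mset v y"]) simp
    qed
  qed
  with that show thesis by blast
qed

lemma fact_dist_eq:
  "fact_dist z z' = max (size (z - z')) (size (z' - z))"
  unfolding fact_dist_def
  by (metis diff_intersect_left_idem inter_mset_def subset_mset.inf_commute)

lemma fact_dist_le: "fact_dist z z' \<le> max (size z) (size z')"
  unfolding fact_dist_eq by (meson diff_subset_eq_self max.mono size_mset_mono)

lemma fact_dist_add: "fact_dist (w + x) (w + y) = fact_dist x y"
  unfolding fact_dist_eq by simp

lemma fact_dist_disjoint:
  assumes "x \<inter># y = {#}"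
  shows "fact_dist x y = max (size x) (size y)"
  using assms unfolding fact_dist_def by simp

lemma size_sum_mset_ge:
  fixes z :: "'p multiset multiset"
  assumes "\<And>v. v \<in># z \<Longrightarrow> k \<le> size v"
  shows "k * size z \<le> size (\<Sum>\<^sub># z)"
  using assms
proof (induction z)
  case (add v z)
  then have "k \<le> size v" "k * size z \<le> size (\<Sum>\<^sub># z)" by auto
  then show ?case by (simp add: add_mono)
qed simp

lemma subset_add_mset_cases:
  assumes "x \<subseteq># add_mset p T"
  obtains "x \<subseteq># T" | x' where "x = add_mset p x'" "x' \<subseteq># T"
proof (cases "p \<in># x")
  case True
  then obtain x' where "x = add_mset p x'" by (metis multi_member_split)
  then show thesis using assms that(2) by simp
next
  case False
  then have "x - {#p#} = x" by simp
  then show thesis using assms that(1) by (metis add_mset_add_single subset_eq_diff_conv)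
qed

lemma size_ge_2E:
  assumes "2 \<le> size u"
  obtains p q w where "u = add_mset p (add_mset q w)"
proof (cases u)
  case (add p u')
  then have "u' \<noteq> {#}" using assms by auto
  then obtain q w where "u' = add_mset q w" by (metis multiset_cases)
  with add that show thesis by simp
qed (use assms in simp)

lemma finite_subset_msets: "finite {x. x \<subseteq># (T :: 'a multiset)}"
proof (induction T)
  case (add p T)
  have "{x. x \<subseteq># add_mset p T} \<subseteq> {x. x \<subseteq># T} \<union> add_mset p ` {x. x \<subseteq># T}"
    by (auto elim: subset_add_mset_cases)
  then show ?case using add.IH by (meson finite_UnI finite_imageI finite_subset)
qed simp

lemma sum_mset_pairs: "\<Sum>\<^sub># (image_mset (\<lambda>p. {#p, f p#}) S) = S + image_mset f S"
  by (induction S) auto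

text \<open>
  Remove one summand \<open>v\<close> at a time: it accounts for at most one element of \<open>b\<close>.
\<close>

lemma size_le_if_inter_le_1:
  assumes "b \<subseteq># \<Sum>\<^sub># z" "\<And>v. v \<in># z \<Longrightarrow> size (v \<inter># b) \<le> 1"
  shows "size b \<le> size z"
  using assms
proof (induction z arbitrary: b)
  case (add v z)
  have "size (v' \<inter># (b - v)) \<le> 1" if "v' \<in># z" for v'
  proof -
    have "v' \<inter># (b - v) \<subseteq># v' \<inter># b" by (rule mset_subset_eqI) auto
    then have "size (v' \<inter># (b - v)) \<le> size (v' \<inter># b)" by (rule size_mset_mono)
    also have "\<dots> \<le> 1" using that by (intro add.prems(2)) simp
    finally show ?thesis .
  qed
  moreover have "b - v \<subseteq># \<Sum>\<^sub># z" using add.prems(1) by (simp add: subset_eq_diff_conv add.commute)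
  ultimately have "size (b - v) \<le> size z" by (intro add.IH)
  moreover have "size b = size (v \<inter># b) + size (b - v)"
  proof -
    have "b = v \<inter># b + (b - v)" by (rule multiset_eqI) auto
    then show ?thesis by (metis size_union)
  qed
  ultimately show ?case using add.prems(2)[of v] by simp
qed simp

text \<open>
  Cancelling the common part leaves disjoint multisets, whose images under an injective map are
  disjoint of the same size.
\<close>

lemma fact_dist_image_mset:
  assumes "inj_on f (set_mset z \<union> set_mset z')"
  shows "fact_dist (image_mset f z) (image_mset f z') = fact_dist z z'"
proof -
  define w where "w = z \<inter># z'"
  define x where "x = z - w"
  define y where "y = z' - w"
  have zx: "z = w + x" and zy: "z' = w + y" unfolding x_def y_def w_def
    by (simp_all del: diff_intersect_left_idem diff_intersect_right_idem)
  have xy: "x \<inter># y = {#}" unfolding x_def y_def w_def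
    by (rule multiset_eqI) auto
  have "image_mset f x \<inter># image_mset f y = {#}"
    using xy assms unfolding zx zy disjunct_not_in inj_on_def by auto
  then show ?thesis
    using xy unfolding zx zy by (simp add: fact_dist_add fact_dist_disjoint)
qed

section \<open>Atoms, factorizations and tame degrees in monoids of multisets\<close>

text \<open>
  The notions of the theory of factorizations for a set \<open>B\<close> of multisets. They are meant for
  saturated \<open>B\<close>, where divisibility in \<open>B\<close> is inclusion of multisets and \<open>{#}\<close> is the only unit.
\<close>

definition mset_atoms :: "'p multiset set \<Rightarrow> 'p multiset set" where
  "mset_atoms B = {u \<in> B. u \<noteq> {#} \<and> (\<forall>x\<in>B. x \<subseteq># u \<longrightarrow> x = {#} \<or> x = u)}"

definition mset_facts :: "'p multiset set \<Rightarrow> 'p multiset \<Rightarrow> 'p multiset multiset set" where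
  "mset_facts B a = {z. set_mset z \<subseteq> mset_atoms B \<and> \<Sum>\<^sub># z = a}"

definition mset_tame :: "'p multiset set \<Rightarrow> 'p multiset \<Rightarrow> 'p multiset \<Rightarrow> enat" where
  "mset_tame B a u = (LEAST N :: enat. \<forall>z\<in>mset_facts B a.
     (\<exists>z'\<in>mset_facts B a. u \<in># z') \<longrightarrow>
     (\<exists>z'\<in>mset_facts B a. u \<in># z' \<and> enat (fact_dist z z') \<le> N))"

definition mset_Ta :: "'p multiset set \<Rightarrow> enat set" where
  "mset_Ta B = {mset_tame B a u | a u. a \<in> B \<and> u \<in> mset_atoms B \<and> mset_tame B a u > 0}"

lemma mset_atomsD:
  assumes "u \<in> mset_atoms B"
  shows "u \<in> B" "u \<noteq> {#}" "\<And>x. x \<in> B \<Longrightarrow> x \<subseteq># u \<Longrightarrow> x = {#} \<or> x = u"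
  using assms unfolding mset_atoms_def by auto

lemma mset_atom_eqI:
  assumes "u \<in> mset_atoms B" "x \<in> B" "x \<noteq> {#}" "x \<subseteq># u"
  shows "x = u"
  using assms mset_atomsD(3) by blast

lemma mset_facts_add:
  assumes "z \<in> mset_facts B a" "y \<in> mset_facts B b"
  shows "z + y \<in> mset_facts B (a + b)"
  using assms unfolding mset_facts_def by auto

lemma mset_facts_single:
  assumes "u \<in> mset_atoms B"
  shows "{#u#} \<in> mset_facts B u"
  using assms unfolding mset_facts_def by auto

lemma mset_facts_subset:
  assumes "z \<in> mset_facts B a" "y \<subseteq># z"
  shows "y \<in> mset_facts B (\<Sum>\<^sub># y)"
  using assms set_mset_mono[of y z] unfolding mset_facts_def by auto

lemma mset_facts_diff:
  assumes "z \<in> mset_facts B (a + b)" "y \<subseteq># z" "y \<in> mset_facts B a"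
  shows "z - y \<in> mset_facts B b"
  using assms in_diffD[of _ z y] unfolding mset_facts_def
  by (auto simp: sum_mset_diff)

lemma size_mset_facts_le:
  assumes "z \<in> mset_facts B a"
  shows "size z \<le> size a"
proof -
  have "1 \<le> size v" if "v \<in># z" for v
  proof -
    have "v \<noteq> {#}" using that assms mset_atomsD(2) unfolding mset_facts_def by blast
    then show ?thesis by (simp add: Suc_le_eq nonempty_has_size)
  qed
  then have "1 * size z \<le> size (\<Sum>\<^sub># z)" by (rule size_sum_mset_ge)
  then show ?thesis using assms unfolding mset_facts_def by (metis (mono_tags, lifting) mem_Collect_eq mult_1)
qed

lemma size_mset_facts_le_half:
  assumes "z \<in> mset_facts B a" "\<And>p. p \<in># a \<Longrightarrow> {#p#} \<notin> B"
  shows "2 * size z \<le> size a"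
proof -
  have "2 \<le> size v" if v: "v \<in># z" for v
  proof (rule ccontr)
    assume *: "\<not> 2 \<le> size v"
    have "v \<in> mset_atoms B" using v assms unfolding mset_facts_def by auto
    with * have "size v = 1" using mset_atomsD(2)[of v B] nonempty_has_size[of v] by linarith
    then obtain p where p: "v = {#p#}" using size_1_singleton_mset by blast
    then have "p \<in># a" using v assms unfolding mset_facts_def by (auto simp: in_Union_mset_iff)
    with assms(2) p \<open>v \<in> mset_atoms B\<close> mset_atomsD(1) show False by metis
  qed
  then have "2 * size z \<le> size (\<Sum>\<^sub># z)" by (rule size_sum_mset_ge)
  then show ?thesis using assms(1) unfolding mset_facts_def by (metis (mono_tags, lifting) mem_Collect_eq)
qed

text \<open>
  The least bound in the definition is attained because \<open>enat\<close> is well-ordered and \<open>\<infinity>\<close> always is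
  a bound. With its negation below, this makes tame degrees accessible from both sides.
\<close>

lemma mset_tame_le_iff:
  "mset_tame B a u \<le> N \<longleftrightarrow> (\<forall>z\<in>mset_facts B a. (\<exists>z'\<in>mset_facts B a. u \<in># z') \<longrightarrow>
     (\<exists>z'\<in>mset_facts B a. u \<in># z' \<and> enat (fact_dist z z') \<le> N))" (is "_ \<longleftrightarrow> ?Q N")
proof
  have "?Q \<infinity>" by auto
  then have "?Q (mset_tame B a u)" unfolding mset_tame_def by (rule LeastI)
  moreover assume "mset_tame B a u \<le> N"
  ultimately show "?Q N" by (meson order_trans)
next
  assume "?Q N"
  then show "mset_tame B a u \<le> N" unfolding mset_tame_def by (rule Least_le)
qed

lemma le_mset_tame_iff:
  assumes "n > 0"
  shows "enat n \<le> mset_tame B a u \<longleftrightarrow> (\<exists>z'\<in>mset_facts B a. u \<in># z') \<and>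
     (\<exists>z\<in>mset_facts B a. \<forall>z'\<in>mset_facts B a. u \<in># z' \<longrightarrow> n \<le> fact_dist z z')"
proof -
  obtain m where m: "n = Suc m" using assms gr0_implies_Suc by blast
  have "enat n \<le> mset_tame B a u \<longleftrightarrow> \<not> mset_tame B a u \<le> enat m"
    unfolding m by (metis Suc_ile_eq not_le)
  also have "\<dots> \<longleftrightarrow> (\<exists>z'\<in>mset_facts B a. u \<in># z') \<and>
     (\<exists>z\<in>mset_facts B a. \<forall>z'\<in>mset_facts B a. u \<in># z' \<longrightarrow> \<not> fact_dist z z' \<le> m)"
    unfolding mset_tame_le_iff by auto
  finally show ?thesis unfolding m by (simp add: not_le Suc_le_eq)
qed

lemma mset_tame_le_size:
  "mset_tame B a u \<le> enat (size a)"
  unfolding mset_tame_le_iff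
proof (intro ballI impI)
  fix z assume z: "z \<in> mset_facts B a" and "\<exists>z'\<in>mset_facts B a. u \<in># z'"
  then obtain z' where z': "z' \<in> mset_facts B a" "u \<in># z'" by blast
  have "fact_dist z z' \<le> size a"
    using fact_dist_le[of z z'] size_mset_facts_le[OF z] size_mset_facts_le[OF z'(1)] by linarith
  with z' show "\<exists>z'\<in>mset_facts B a. u \<in># z' \<and> enat (fact_dist z z') \<le> enat (size a)" by auto
qed

text \<open>
  After cancellation of the common part, two factorizations with at most one atom left on each
  side would have the same atom left, or none.
\<close>

lemma fact_dist_ge_2:
  assumes "z \<in> mset_facts B a" "z' \<in> mset_facts B a" "z \<noteq> z'"
  shows "2 \<le> fact_dist z z'"
proof (rule ccontr)
  define w where "w = z \<inter># z'"
  define x where "x = z - w"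
  define y where "y = z' - w"
  have zx: "z = w + x" and zy: "z' = w + y" unfolding x_def y_def w_def by (simp_all del: diff_intersect_left_idem diff_intersect_right_idem)
  have xy: "x \<inter># y = {#}" unfolding x_def y_def w_def
    by (rule multiset_eqI) auto
  assume "\<not> ?thesis"
  then have s: "size x \<le> 1" "size y \<le> 1"
    unfolding fact_dist_def x_def y_def w_def by auto
  have at: "set_mset x \<subseteq> mset_atoms B" "set_mset y \<subseteq> mset_atoms B" "\<Sum>\<^sub># x = \<Sum>\<^sub># y"
    using assms(1,2) unfolding mset_facts_def zx zy by auto
  have "x = {#} \<or> (\<exists>v. x = {#v#})" "y = {#} \<or> (\<exists>v. y = {#v#})"
    using s by (metis One_nat_def le_Suc_eq le_zero_eq size_1_singleton_mset size_eq_0_iff_empty)+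
  then show False
    using at xy assms(3) mset_atomsD(2)[of _ B] unfolding zx zy by auto
qed

lemma mset_Ta_cases:
  assumes "t \<in> mset_Ta B"
  obtains n where "t = enat n" "2 \<le> n"
proof -
  obtain a u where t: "t = mset_tame B a u" "t > 0"
    using assms unfolding mset_Ta_def by auto
  obtain n where n: "t = enat n"
    using mset_tame_le_size[of B a u] t by (metis enat_ile)
  then have "enat 1 \<le> mset_tame B a u" using t by (simp add: Suc_ile_eq one_enat_def[symmetric] ileI1 flip: eSuc_enat zero_enat_def)
  then obtain z z0 where z: "z0 \<in> mset_facts B a" "u \<in># z0" "z \<in> mset_facts B a"
    "\<And>z'. z' \<in> mset_facts B a \<Longrightarrow> u \<in># z' \<Longrightarrow> 1 \<le> fact_dist z z'"
    using le_mset_tame_iff[of 1 B a u] by auto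
  have "2 \<le> fact_dist z z'" if "z' \<in> mset_facts B a" "u \<in># z'" for z'
  proof (rule fact_dist_ge_2[OF z(3) that(1)])
    have "fact_dist z z = 0" unfolding fact_dist_eq by simp
    then show "z \<noteq> z'" using z(4)[OF that] by auto
  qed
  then have "enat 2 \<le> t" using le_mset_tame_iff[of 2 B a u] z t by auto
  then show ?thesis using that n by auto
qed

lemma mset_TaI:
  assumes "0 < n" "a \<in> B" "u \<in> mset_atoms B"
    and "\<And>z. z \<in> mset_facts B a \<Longrightarrow> \<exists>z'\<in>mset_facts B a. u \<in># z' \<and> fact_dist z z' \<le> n"
    and "z \<in> mset_facts B a" "\<And>z'. z' \<in> mset_facts B a \<Longrightarrow> u \<in># z' \<Longrightarrow> n \<le> fact_dist z z'"
  shows "enat n \<in> mset_Ta B"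
proof -
  have "mset_tame B a u \<le> enat n" using assms(4) unfolding mset_tame_le_iff by auto
  moreover have "enat n \<le> mset_tame B a u"
    using assms(1,4-) le_mset_tame_iff[of n B a u] by blast
  ultimately have "mset_tame B a u = enat n" by simp
  then show ?thesis using assms(1-3) unfolding mset_Ta_def
    by (metis (mono_tags, lifting) CollectI enat_0 enat_ord_simps(2))
qed

lemma mset_facts_empty: "z \<in> mset_facts B {#} \<Longrightarrow> z = {#}"
  using size_mset_facts_le[of z B "{#}"] by simp

text \<open>
  Factorizations of \<open>S + T\<close> concentrate \<open>S\<close> in at most \<open>|S|\<close> atoms; the remaining atoms divide
  \<open>T\<close>. Applied with \<open>|S| = 2\<close>, this bounds lengths of factorizations.
\<close>

lemma facts_cover:
  assumes "g \<in> mset_facts B (S + T)"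
  obtains y where "y \<subseteq># g" "size y \<le> size S" "\<Sum>\<^sub># y + \<Sum>\<^sub># (g - y) = S + T"
    "\<Sum>\<^sub># (g - y) \<subseteq># T"
proof -
  have g: "\<Sum>\<^sub># g = S + T" using assms unfolding mset_facts_def by auto
  then obtain y where y: "y \<subseteq># g" "S \<subseteq># \<Sum>\<^sub># y" "size y \<le> size S"
    using subset_mset_sum_cover[of S g] by auto
  have sum: "\<Sum>\<^sub># y + \<Sum>\<^sub># (g - y) = S + T"
    using y(1) g by (metis subset_mset.add_diff_inverse sum_mset.union)
  have "S + \<Sum>\<^sub># (g - y) \<subseteq># S + T"
    unfolding sum[symmetric] using y(2) by (rule subset_mset.add_right_mono)
  then have "\<Sum>\<^sub># (g - y) \<subseteq># T" by simp
  with that y sum show thesis by blast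
qed

locale saturated_msets =
  fixes B :: "'p multiset set"
  assumes empty_closed: "{#} \<in> B"
    and union_closed: "x \<in> B \<Longrightarrow> y \<in> B \<Longrightarrow> x + y \<in> B"
    and cancel_closed: "x \<in> B \<Longrightarrow> x + y \<in> B \<Longrightarrow> y \<in> B"
begin

lemma diff_closed:
  assumes "x \<subseteq># y" "x \<in> B" "y \<in> B"
  shows "y - x \<in> B"
  using assms cancel_closed[of x "y - x"] by simp

lemma atomI:
  assumes "u \<in> B" "u \<noteq> {#}"
    "\<And>x y. x \<in> B \<Longrightarrow> y \<in> B \<Longrightarrow> u = x + y \<Longrightarrow> x = {#} \<or> y = {#}"
  shows "u \<in> mset_atoms B"
proof -
  have "x = {#} \<or> x = u" if "x \<in> B" "x \<subseteq># u" for x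
    using that assms(3)[of x "u - x"] diff_closed[OF that(2,1) assms(1)]
    by (metis add.right_neutral subset_mset.add_diff_inverse)
  then show ?thesis using assms(1,2) unfolding mset_atoms_def by auto
qed

lemma pair_atom:
  assumes "{#p, q#} \<in> B" "{#p#} \<notin> B" "{#q#} \<notin> B"
  shows "{#p, q#} \<in> mset_atoms B"
proof -
  have "x = {#p, q#}" if x: "x \<in> B" "x \<subseteq># {#p, q#}" "x \<noteq> {#}" for x
  proof (rule ccontr)
    assume "x \<noteq> {#p, q#}"
    with x(2) have "size x < size {#p, q#}" by (intro mset_subset_size) (simp add: subset_mset.less_le)
    moreover have "0 < size x" using x(3) by (simp add: nonempty_has_size)
    ultimately have "size x = 1" by simp
    then obtain r where r: "x = {#r#}" using size_1_singleton_mset by blast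
    then have "r \<in># {#p, q#}" using x(2) by simp
    then show False using x(1) r assms(2,3) by auto
  qed
  then show ?thesis using assms(1) unfolding mset_atoms_def by auto
qed

lemma sum_closed: "set_mset z \<subseteq> B \<Longrightarrow> \<Sum>\<^sub># z \<in> B"
  by (induction z) (auto simp: empty_closed union_closed)

lemma facts_closed: "z \<in> mset_facts B a \<Longrightarrow> a \<in> B"
  using sum_closed[of z] mset_atomsD(1) unfolding mset_facts_def by blast

lemma facts_exist:
  assumes "a \<in> B"
  obtains z where "z \<in> mset_facts B a"
proof -
  have "\<exists>z. z \<in> mset_facts B a"
    using assms
  proof (induction "size a" arbitrary: a rule: less_induct)
    case less
    consider "a = {#}" | "a \<in> mset_atoms B"
      | x y where "x \<in> B" "y \<in> B" "a = x + y" "x \<noteq> {#}" "y \<noteq> {#}"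
      using less.prems atomI by metis
    then show ?case
    proof cases
      case 1
      then show ?thesis by (intro exI[of _ "{#}"]) (simp add: mset_facts_def)
    next
      case 2
      then show ?thesis using mset_facts_single by blast
    next
      case 3
      then have "size x < size a" "size y < size a" by (simp_all add: nonempty_has_size)
      with 3 less.hyps[of x] less.hyps[of y] mset_facts_add show ?thesis by metis
    qed
  qed
  with that show thesis by blast
qed

lemma facts_with_exist:
  assumes "a \<in> B" "u \<in> mset_atoms B" "u \<subseteq># a"
  obtains z where "z \<in> mset_facts B (a - u)" "add_mset u z \<in> mset_facts B a"
proof -
  have "a - u \<in> B" using assms mset_atomsD(1) diff_closed by blast
  then obtain z where z: "z \<in> mset_facts B (a - u)" using facts_exist by blast
  from mset_facts_add[OF mset_facts_single[OF assms(2)] this] assms(3)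
  show ?thesis using that z by simp
qed

lemma facts_of_atom:
  assumes "u \<in> mset_atoms B" "z \<in> mset_facts B u"
  shows "z = {#u#}"
proof -
  have "z \<noteq> {#}" using assms(2) mset_atomsD(2)[OF assms(1)] unfolding mset_facts_def by auto
  then obtain v y where z: "z = add_mset v y" by (metis multiset_cases)
  then have v: "v \<in> mset_atoms B" "u = v + \<Sum>\<^sub># y" "set_mset y \<subseteq> mset_atoms B"
    using assms(2) unfolding mset_facts_def by auto
  have "v = u"
    by (rule mset_atom_eqI[OF assms(1) mset_atomsD(1,2)[OF v(1)]]) (simp add: v(2))
  with v(2) have sum: "\<Sum>\<^sub># y = {#}" by simp
  have "y = {#}"
  proof (rule ccontr)
    assume "y \<noteq> {#}"
    then obtain w where "w \<in># y" by blast
    then show False using sum v(3) mset_atomsD(2)[of w B] by auto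
  qed
  with z \<open>v = u\<close> show ?thesis by simp
qed

text \<open>
  Distances are at least 2, and they are at most the larger of the two lengths.
\<close>

lemma tame_eq_2I:
  assumes "a \<in> B" "u \<in> mset_atoms B" "u \<subseteq># a"
    and len: "\<And>z. z \<in> mset_facts B a \<Longrightarrow> size z \<le> 2"
    and z: "z \<in> mset_facts B a" "u \<notin># z"
  shows "2 \<in> mset_Ta B"
proof -
  obtain z0 where z0: "add_mset u z0 \<in> mset_facts B a"
    by (rule facts_with_exist[OF assms(1-3)])
  have "enat 2 \<in> mset_Ta B"
  proof (rule mset_TaI[of 2 a B u z])
    fix y assume y: "y \<in> mset_facts B a"
    have "fact_dist y (add_mset u z0) \<le> 2"
      using fact_dist_le[of y "add_mset u z0"] len[OF y] len[OF z0] by linarith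
    then show "\<exists>z'\<in>mset_facts B a. u \<in># z' \<and> fact_dist y z' \<le> 2"
      by (intro bexI[OF _ z0]) simp
  next
    fix z' assume "z' \<in> mset_facts B a" "u \<in># z'"
    with z show "2 \<le> fact_dist z z'" using fact_dist_ge_2[of z B a z'] by auto
  qed (use assms in simp_all)
  then show ?thesis by (simp add: numeral_eq_enat)
qed

end

section \<open>From a monoid with a divisor homomorphism to a monoid of multisets\<close>

context comm_monoid
begin

lemma mset_prod_eq_finprod:
  assumes "finite A" "set_mset S \<subseteq> A" "A \<subseteq> carrier G"
  shows "mset_prod G S = (\<Otimes>g\<in>A. g [^] count S g)"
  unfolding mset_prod_def using assms
  by (intro finprod_mono_neutral_cong_left) (auto simp: not_in_iff)

lemma mset_prod_empty [simp]: "mset_prod G {#} = \<one>"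
  by (simp add: mset_prod_def)

lemma mset_prod_closed:
  assumes "set_mset S \<subseteq> carrier G"
  shows "mset_prod G S \<in> carrier G"
  unfolding mset_prod_def using assms by (intro finprod_closed) auto

lemma mset_prod_union:
  assumes "set_mset S \<subseteq> carrier G" "set_mset T \<subseteq> carrier G"
  shows "mset_prod G (S + T) = mset_prod G S \<otimes> mset_prod G T"
proof -
  let ?A = "set_mset S \<union> set_mset T"
  have A: "finite ?A" "?A \<subseteq> carrier G" using assms by auto
  have "mset_prod G (S + T) = (\<Otimes>g\<in>?A. g [^] count (S + T) g)"
    by (rule mset_prod_eq_finprod[OF A(1) _ A(2)]) simp
  also have "\<dots> = (\<Otimes>g\<in>?A. g [^] count S g \<otimes> g [^] count T g)"
    using A(2) by (intro finprod_cong') (auto simp: nat_pow_mult)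
  also have "\<dots> = (\<Otimes>g\<in>?A. g [^] count S g) \<otimes> (\<Otimes>g\<in>?A. g [^] count T g)"
    using A(2) by (intro finprod_multf) auto
  also have "(\<Otimes>g\<in>?A. g [^] count S g) = mset_prod G S"
    by (rule mset_prod_eq_finprod[OF A(1) _ A(2), symmetric]) simp
  also have "(\<Otimes>g\<in>?A. g [^] count T g) = mset_prod G T"
    by (rule mset_prod_eq_finprod[OF A(1) _ A(2), symmetric]) simp
  finally show ?thesis .
qed

lemma mset_prod_single [simp]:
  assumes "g \<in> carrier G"
  shows "mset_prod G {#g#} = g"
  using assms by (simp add: mset_prod_def)

lemma mset_prod_add_mset:
  assumes "g \<in> carrier G" "set_mset S \<subseteq> carrier G"
  shows "mset_prod G (add_mset g S) = g \<otimes> mset_prod G S"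
  using mset_prod_union[of "{#g#}" S] assms by simp

end

text \<open>
  A homomorphism into a free abelian monoid that reflects divisibility. This is the part of a
  divisor theory on which factorizations depend. It also covers the inclusion of the monoid of
  zero-sum sequences over a group into the free monoid, which fails to be a divisor theory for
  the group of order two.
\<close>

locale divisor_hom = comm_monoid_cancel H for H (structure) +
  fixes \<phi> :: "'a \<Rightarrow> 'p multiset"
  assumes hom_mult: "a \<in> carrier H \<Longrightarrow> b \<in> carrier H \<Longrightarrow> \<phi> (a \<otimes> b) = \<phi> a + \<phi> b"
    and divides_reflect: "a \<in> carrier H \<Longrightarrow> b \<in> carrier H \<Longrightarrow> \<phi> a \<subseteq># \<phi> b \<Longrightarrow> a divides b"
begin

abbreviation divs :: "'p multiset set" where "divs \<equiv> \<phi> ` carrier H"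

abbreviation coset :: "'a \<Rightarrow> 'a set" where "coset a \<equiv> Units H #>\<^bsub>H\<^esub> a"

abbreviation Hred :: "'a set monoid" where "Hred \<equiv> reduced_monoid H"

text \<open>
  As units are mapped to \<open>{#}\<close>, \<open>\<phi>\<close> takes a single value on each coset.
\<close>

definition \<psi> :: "'a set \<Rightarrow> 'p multiset" where "\<psi> C = the_elem (\<phi> ` C)"

lemma hom_one: "\<phi> \<one> = {#}"
  using hom_mult[of \<one> \<one>] by simp

lemma hom_unit: "h \<in> Units H \<Longrightarrow> \<phi> h = {#}"
  using hom_mult[of "inv h" h] by (auto simp: hom_one)

lemma divides_iff:
  assumes "a \<in> carrier H" "b \<in> carrier H"
  shows "a divides b \<longleftrightarrow> \<phi> a \<subseteq># \<phi> b"
  using assms divides_reflect by (auto simp: factor_def hom_mult)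

lemma saturated: "saturated_msets divs"
proof
  show "{#} \<in> divs" using imageI[OF one_closed, of \<phi>] hom_one by simp
next
  fix x y assume "x \<in> divs" "y \<in> divs"
  then show "x + y \<in> divs" by (auto simp: hom_mult[symmetric])
next
  fix x y assume "x \<in> divs" "x + y \<in> divs"
  then obtain a b where ab: "a \<in> carrier H" "b \<in> carrier H" "x = \<phi> a" "x + y = \<phi> b" by auto
  then have "a divides b" using divides_reflect by (metis mset_subset_eq_add_left)
  then obtain c where "c \<in> carrier H" "b = a \<otimes> c" by (auto simp: factor_def)
  with ab have "y = \<phi> c" using hom_mult by simp
  with \<open>c \<in> carrier H\<close> show "y \<in> divs" by simp
qed

lemma image_coset:
  assumes "a \<in> carrier H"
  shows "\<phi> ` coset a = {\<phi> a}"
proof -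
  have "\<phi> (h \<otimes> a) = \<phi> a" if "h \<in> Units H" for h
    using that assms by (simp add: hom_mult hom_unit Units_closed)
  then have "\<phi> ` coset a = (\<lambda>_. \<phi> a) ` Units H"
    unfolding r_coset_def by (simp add: UNION_singleton_eq_range image_image cong: image_cong)
  also have "\<dots> = {\<phi> a}" by (rule image_constant[OF Units_one_closed])
  finally show ?thesis .
qed

lemma \<psi>_coset: "a \<in> carrier H \<Longrightarrow> \<psi> (coset a) = \<phi> a"
  unfolding \<psi>_def by (simp add: image_coset)

text \<open>
  Elements with the same image divide each other, so they differ by a unit.
\<close>

lemma coset_subset:
  assumes "a \<in> carrier H" "b \<in> carrier H" "\<phi> a = \<phi> b"
  shows "coset b \<subseteq> coset a"
proof -
  obtain c d where c: "c \<in> carrier H" "b = a \<otimes> c" and d: "d \<in> carrier H" "a = b \<otimes> d"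
    using divides_reflect[of a b] divides_reflect[of b a] assms by (auto simp: factor_def)
  have "a \<otimes> (c \<otimes> d) = (a \<otimes> c) \<otimes> d" using assms c(1) d(1) by (simp add: m_assoc)
  also have "\<dots> = a \<otimes> \<one>" using c(2)[symmetric] d(2)[symmetric] assms by simp
  finally have "a \<otimes> (c \<otimes> d) = a \<otimes> \<one>" .
  then have "c \<otimes> d = \<one>" using assms c d l_cancel by blast
  then have cU: "c \<in> Units H" 
    unfolding Units_def using c(1) d(1) m_comm[of d c] by auto
  have "h \<otimes> b \<in> coset a" if h: "h \<in> Units H" for h
  proof -
    have "h \<otimes> b = (h \<otimes> c) \<otimes> a"
      using h c assms by (simp add: Units_closed m_ac)
    moreover have "h \<otimes> c \<in> Units H" using h cU by simp
    ultimately show ?thesis unfolding r_coset_def by auto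
  qed
  then show ?thesis by (auto simp: r_coset_def[of H "Units H" b])
qed

lemma coset_eq_iff:
  assumes "a \<in> carrier H" "b \<in> carrier H"
  shows "coset a = coset b \<longleftrightarrow> \<phi> a = \<phi> b"
  using assms coset_subset[of a b] coset_subset[of b a] \<psi>_coset by (metis subset_antisym)

lemma coset_mult:
  assumes "a \<in> carrier H" "b \<in> carrier H"
  shows "coset a \<otimes>\<^bsub>Hred\<^esub> coset b = coset (a \<otimes> b)"
proof -
  have "coset a <#> coset b = coset (a \<otimes> b)"
  proof (intro subset_antisym subsetI)
    fix x assume "x \<in> coset a <#> coset b"
    then obtain h k where hk: "h \<in> Units H" "k \<in> Units H" "x = (h \<otimes> a) \<otimes> (k \<otimes> b)"
      unfolding r_coset_def set_mult_def by auto
    then have "x = (h \<otimes> k) \<otimes> (a \<otimes> b)" using assms by (simp add: Units_closed m_ac)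
    then show "x \<in> coset (a \<otimes> b)" using hk unfolding r_coset_def by auto
  next
    fix x assume "x \<in> coset (a \<otimes> b)"
    then obtain h where h: "h \<in> Units H" "x = h \<otimes> (a \<otimes> b)" unfolding r_coset_def by auto
    then have "x = (h \<otimes> a) \<otimes> (\<one> \<otimes> b)" using assms by (simp add: Units_closed m_assoc)
    then show "x \<in> coset a <#> coset b"
      using h Units_one_closed unfolding r_coset_def set_mult_def by blast
  qed
  then show ?thesis by (simp add: reduced_monoid_def FactGroup_def)
qed

lemma carrier_Hred: "carrier Hred = coset ` carrier H"
  by (auto simp: reduced_monoid_def FactGroup_def RCOSETS_def)

lemma coset_one: "coset \<one> = \<one>\<^bsub>Hred\<^esub>"
proof -
  have "coset \<one> = Units H" unfolding r_coset_def by (auto simp: Units_closed)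
  then show ?thesis by (simp add: reduced_monoid_def FactGroup_def)
qed

lemma comm_monoid_Hred: "comm_monoid Hred"
proof (rule comm_monoidI)
  show "\<one>\<^bsub>Hred\<^esub> \<in> carrier Hred" unfolding carrier_Hred coset_one[symmetric] by simp
  show "\<And>x. x \<in> carrier Hred \<Longrightarrow> \<one>\<^bsub>Hred\<^esub> \<otimes>\<^bsub>Hred\<^esub> x = x"
    unfolding carrier_Hred coset_one[symmetric] by (auto simp: coset_mult)
qed (auto simp: carrier_Hred coset_mult m_ac)

lemma \<psi>_inj: "inj_on \<psi> (carrier Hred)"
proof (rule inj_onI)
  fix C D assume "C \<in> carrier Hred" "D \<in> carrier Hred" and eq: "\<psi> C = \<psi> D"
  then obtain a b where "C = coset a" "D = coset b" "a \<in> carrier H" "b \<in> carrier H"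
    unfolding carrier_Hred by blast
  with eq show "C = D" by (simp add: \<psi>_coset coset_eq_iff)
qed

lemma \<psi>_mult: "x \<in> carrier Hred \<Longrightarrow> y \<in> carrier Hred \<Longrightarrow> \<psi> (x \<otimes>\<^bsub>Hred\<^esub> y) = \<psi> x + \<psi> y"
  by (auto simp: carrier_Hred coset_mult \<psi>_coset hom_mult)

lemma \<psi>_mset_prod:
  assumes "set_mset z \<subseteq> carrier Hred"
  shows "mset_prod Hred z \<in> carrier Hred \<and> \<psi> (mset_prod Hred z) = \<Sum>\<^sub># (image_mset \<psi> z)"
proof -
  interpret Hred: comm_monoid Hred by (rule comm_monoid_Hred)
  show ?thesis using assms
  proof (induction z)
    case empty
    then show ?case using \<psi>_coset[of \<one>] by (simp add: coset_one hom_one)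
  next
    case (add x z)
    then show ?case by (simp add: Hred.mset_prod_add_mset \<psi>_mult)
  qed
qed

lemma coset_divides_iff:
  assumes "a \<in> carrier H" "b \<in> carrier H"
  shows "coset a divides\<^bsub>Hred\<^esub> coset b \<longleftrightarrow> \<phi> a \<subseteq># \<phi> b"
proof
  assume "coset a divides\<^bsub>Hred\<^esub> coset b"
  then obtain c where "c \<in> carrier H" "coset b = coset (a \<otimes> c)"
    using assms by (auto simp: factor_def carrier_Hred coset_mult)
  then show "\<phi> a \<subseteq># \<phi> b" using assms by (simp add: coset_eq_iff hom_mult)
next
  assume "\<phi> a \<subseteq># \<phi> b"
  then obtain c where "c \<in> carrier H" "b = a \<otimes> c"
    using divides_reflect assms by (auto simp: factor_def)
  then show "coset a divides\<^bsub>Hred\<^esub> coset b"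
    using assms by (auto simp: factor_def carrier_Hred coset_mult)
qed

lemma coset_unit_iff:
  assumes "a \<in> carrier H"
  shows "coset a \<in> Units Hred \<longleftrightarrow> \<phi> a = {#}"
proof
  interpret Hred: comm_monoid Hred by (rule comm_monoid_Hred)
  assume "coset a \<in> Units Hred"
  then have "coset a divides\<^bsub>Hred\<^esub> coset \<one>" unfolding coset_one by (metis Hred.unit_divides Hred.one_closed)
  then show "\<phi> a = {#}" using assms by (simp add: coset_divides_iff hom_one)
next
  interpret Hred: comm_monoid Hred by (rule comm_monoid_Hred)
  assume "\<phi> a = {#}"
  then have "coset a = \<one>\<^bsub>Hred\<^esub>" using coset_eq_iff[of a \<one>] assms by (simp add: coset_one hom_one)
  then show "coset a \<in> Units Hred" by simp
qed

lemma coset_atom_iff: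
  assumes "a \<in> carrier H"
  shows "coset a \<in> atoms Hred \<longleftrightarrow> \<phi> a \<in> mset_atoms divs"
proof -
  have "coset a \<in> atoms Hred \<longleftrightarrow>
    \<phi> a \<noteq> {#} \<and> (\<forall>b\<in>carrier H. \<phi> b \<subseteq># \<phi> a \<and> \<not> \<phi> a \<subseteq># \<phi> b \<longrightarrow> \<phi> b = {#})"
    using assms unfolding atoms_def irreducible_def properfactor_def
    by (simp add: carrier_Hred coset_divides_iff coset_unit_iff)
  also have "\<dots> \<longleftrightarrow> \<phi> a \<in> mset_atoms divs"
    using assms unfolding mset_atoms_def by (auto dest: subset_mset.antisym)
  finally show ?thesis .
qed

lemma atom_iff:
  assumes "a \<in> carrier H"
  shows "a \<in> atoms H \<longleftrightarrow> \<phi> a \<in> mset_atoms divs"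
proof -
  have unit: "b \<in> Units H \<longleftrightarrow> \<phi> b = {#}" if "b \<in> carrier H" for b
    using that divides_iff[of b \<one>] hom_unit divides_unit[of b \<one>] by (auto simp: hom_one)
  have "a \<in> atoms H \<longleftrightarrow>
    \<phi> a \<noteq> {#} \<and> (\<forall>b\<in>carrier H. \<phi> b \<subseteq># \<phi> a \<and> \<not> \<phi> a \<subseteq># \<phi> b \<longrightarrow> \<phi> b = {#})"
    using assms unfolding atoms_def irreducible_def properfactor_def
    by (simp add: divides_iff unit)
  also have "\<dots> \<longleftrightarrow> \<phi> a \<in> mset_atoms divs"
    using assms unfolding mset_atoms_def by (auto dest: subset_mset.antisym)
  finally show ?thesis .
qed

lemma bij_betw_atoms: "bij_betw \<psi> (atoms Hred) (mset_atoms divs)"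
proof (rule bij_betw_imageI)
  show "inj_on \<psi> (atoms Hred)" using \<psi>_inj by (rule inj_on_subset) (auto simp: atoms_def)
  show "\<psi> ` atoms Hred = mset_atoms divs"
  proof (intro subset_antisym subsetI)
    fix u assume "u \<in> \<psi> ` atoms Hred"
    then obtain C where "C \<in> atoms Hred" "u = \<psi> C" by auto
    moreover from this obtain a where "a \<in> carrier H" "C = coset a"
      by (auto simp: atoms_def carrier_Hred)
    ultimately show "u \<in> mset_atoms divs" by (simp add: coset_atom_iff \<psi>_coset)
  next
    fix u assume u: "u \<in> mset_atoms divs"
    then obtain a where "a \<in> carrier H" "u = \<phi> a" using mset_atomsD(1) by blast
    with u show "u \<in> \<psi> ` atoms Hred" using coset_atom_iff \<psi>_coset by (metis image_eqI)
  qed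
qed

lemma factorizations_eq:
  "factorizations H a = {z. set_mset z \<subseteq> atoms Hred \<and> mset_prod Hred z = coset a}"
  by (auto simp: factorizations_def factorization_monoid_def free_comm_monoid_def)

text \<open>
  \<open>\<psi>\<close> is an isomorphism of the reduced monoid onto \<open>divs\<close> and maps atoms bijectively to atoms,
  so it can be applied to each atom of a factorization.
\<close>

lemma facts_eq_image:
  assumes "a \<in> carrier H"
  shows "mset_facts divs (\<phi> a) = image_mset \<psi> ` factorizations H a"
proof -
  have atoms: "atoms Hred \<subseteq> carrier Hred" by (auto simp: atoms_def)
  have *: "image_mset \<psi> z \<in> mset_facts divs (\<phi> a) \<longleftrightarrow> mset_prod Hred z = coset a"
    if z: "set_mset z \<subseteq> atoms Hred" for z
  proof -
    have prod: "mset_prod Hred z \<in> carrier Hred" "\<psi> (mset_prod Hred z) = \<Sum>\<^sub># (image_mset \<psi> z)"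
      using \<psi>_mset_prod[of z] z atoms by auto
    have "coset a \<in> carrier Hred" using assms by (simp add: carrier_Hred)
    then have "mset_prod Hred z = coset a \<longleftrightarrow> \<psi> (mset_prod Hred z) = \<psi> (coset a)"
      using inj_on_eq_iff[OF \<psi>_inj prod(1)] by simp
    also have "\<dots> \<longleftrightarrow> \<Sum>\<^sub># (image_mset \<psi> z) = \<phi> a"
      by (simp only: prod(2) \<psi>_coset[OF assms])
    also have "\<dots> \<longleftrightarrow> image_mset \<psi> z \<in> mset_facts divs (\<phi> a)"
      using z bij_betw_imp_surj_on[OF bij_betw_atoms] unfolding mset_facts_def by auto
    finally show ?thesis by simp
  qed
  show ?thesis
  proof (intro subset_antisym subsetI)
    fix y assume y: "y \<in> mset_facts divs (\<phi> a)"
    define z where "z = image_mset (inv_into (atoms Hred) \<psi>) y"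
    have yat: "set_mset y \<subseteq> \<psi> ` atoms Hred"
      using y bij_betw_imp_surj_on[OF bij_betw_atoms] unfolding mset_facts_def by auto
    then have "set_mset z \<subseteq> atoms Hred" unfolding z_def by (auto intro: inv_into_into)
    moreover have "image_mset \<psi> z = y"
      unfolding z_def image_mset.compositionality comp_def
      using yat by (intro trans[OF image_mset_cong multiset.map_ident]) (auto simp: f_inv_into_f)
    ultimately show "y \<in> image_mset \<psi> ` factorizations H a"
      using *[of z] y unfolding factorizations_eq by blast
  qed (auto simp: factorizations_eq *)
qed

lemma tame_degree_at_eq:
  assumes "a \<in> carrier H" "u \<in> atoms Hred"
  shows "tame_degree_at H a u = mset_tame divs (\<phi> a) (\<psi> u)"
proof -
  let ?Z = "factorizations H a"
  have inj: "inj_on \<psi> (atoms Hred)" using bij_betw_atoms by (rule bij_betw_imp_inj_on)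
  have facts_with: "factorizations_with H a u = {z \<in> ?Z. u \<in># z}"
    unfolding factorizations_with_def factorization_monoid_def free_comm_monoid_def factorizations_eq
    by (auto dest!: multi_member_split)
  have mem: "\<psi> u \<in># image_mset \<psi> z \<longleftrightarrow> u \<in># z" if "z \<in> ?Z" for z
    using that assms(2) inj unfolding factorizations_eq inj_on_def by auto
  have dist: "fact_dist (image_mset \<psi> z) (image_mset \<psi> z') = fact_dist z z'"
    if "z \<in> ?Z" "z' \<in> ?Z" for z z'
    using that by (intro fact_dist_image_mset inj_on_subset[OF inj]) (auto simp: factorizations_eq)
  let ?F = "image_mset \<psi>"
  have "(\<forall>z\<in>mset_facts divs (\<phi> a). (\<exists>z'\<in>mset_facts divs (\<phi> a). \<psi> u \<in># z') \<longrightarrow>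
      (\<exists>z'\<in>mset_facts divs (\<phi> a). \<psi> u \<in># z' \<and> enat (fact_dist z z') \<le> N)) \<longleftrightarrow>
    (\<forall>z\<in>?Z. factorizations_with H a u \<noteq> {} \<longrightarrow>
      (\<exists>z'\<in>factorizations_with H a u. enat (fact_dist z z') \<le> N))" (is "?L \<longleftrightarrow> ?R") for N
  proof -
    have "?L \<longleftrightarrow> (\<forall>z\<in>?Z. (\<exists>z'\<in>?Z. \<psi> u \<in># ?F z') \<longrightarrow>
        (\<exists>z'\<in>?Z. \<psi> u \<in># ?F z' \<and> enat (fact_dist (?F z) (?F z')) \<le> N))"
      by (simp only: facts_eq_image[OF assms(1)] ball_simps bex_simps)
    also have "\<dots> \<longleftrightarrow> (\<forall>z\<in>?Z. (\<exists>z'\<in>?Z. u \<in># z') \<longrightarrow>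
        (\<exists>z'\<in>?Z. u \<in># z' \<and> enat (fact_dist z z') \<le> N))"
      by (intro ball_cong imp_cong bex_cong conj_cong refl) (simp_all only: mem dist)
    also have "\<dots> \<longleftrightarrow> ?R" unfolding facts_with by blast
    finally show ?thesis .
  qed
  then show ?thesis unfolding tame_degree_at_def mset_tame_def by simp
qed

theorem Ta_eq: "Ta H = mset_Ta divs"
proof -
  have "Ta H = {mset_tame divs (\<phi> a) (\<psi> u) | a u. a \<in> carrier H \<and> u \<in> atoms Hred \<and>
      mset_tame divs (\<phi> a) (\<psi> u) > 0}"
    unfolding Ta_def using tame_degree_at_eq by (metis (no_types, lifting))
  also have "\<dots> = mset_Ta divs"
    unfolding mset_Ta_def bij_betw_imp_surj_on[OF bij_betw_atoms, symmetric] by blast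
  finally show ?thesis .
qed

end

section \<open>Zero-sum multisets over a set of primes with prescribed classes\<close>

text \<open>
  A set \<open>P\<close> of primes, each with a class in the group \<open>G\<close>, such that every class contains a
  prime. The multisets of primes with trivial class form the monoid \<open>ZS\<close>: it is a reduced Krull
  monoid, and it is the monoid of zero-sum sequences over \<open>G\<close> if \<open>c\<close> is the identity on
  \<open>P = carrier G\<close>.
\<close>

locale class_map = comm_group G for G (structure) +
  fixes P :: "'p set" and c :: "'p \<Rightarrow> 'a"
  assumes c_onto: "c ` P = carrier G"
begin

definition \<sigma> :: "'p multiset \<Rightarrow> 'a" where "\<sigma> S = mset_prod G (image_mset c S)"

definition ZS :: "'p multiset set" where "ZS = {S. set_mset S \<subseteq> P \<and> \<sigma> S = \<one>}"

lemma c_closed [simp]: "p \<in> P \<Longrightarrow> c p \<in> carrier G"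
  using c_onto by blast

lemma classes_closed: "set_mset S \<subseteq> P \<Longrightarrow> set_mset (image_mset c S) \<subseteq> carrier G"
  using c_onto by auto

lemma \<sigma>_closed [simp]: "set_mset S \<subseteq> P \<Longrightarrow> \<sigma> S \<in> carrier G"
  unfolding \<sigma>_def by (intro mset_prod_closed classes_closed)

lemma \<sigma>_empty [simp]: "\<sigma> {#} = \<one>"
  by (simp add: \<sigma>_def)

lemma \<sigma>_union: "set_mset S \<subseteq> P \<Longrightarrow> set_mset T \<subseteq> P \<Longrightarrow> \<sigma> (S + T) = \<sigma> S \<otimes> \<sigma> T"
  unfolding \<sigma>_def image_mset_union by (intro mset_prod_union classes_closed)

lemma \<sigma>_add_mset: "p \<in> P \<Longrightarrow> set_mset S \<subseteq> P \<Longrightarrow> \<sigma> (add_mset p S) = c p \<otimes> \<sigma> S"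
  unfolding \<sigma>_def image_mset_add_mset by (intro mset_prod_add_mset classes_closed c_closed)

lemma obtain_prime:
  assumes "g \<in> carrier G"
  obtains p where "p \<in> P" "c p = g"
  using assms that unfolding c_onto[symmetric] by auto

lemma ZS_subset: "S \<in> ZS \<Longrightarrow> set_mset S \<subseteq> P"
  by (simp add: ZS_def)

lemma ZS_\<sigma>: "S \<in> ZS \<Longrightarrow> \<sigma> S = \<one>"
  by (simp add: ZS_def)

lemma saturated_ZS: "saturated_msets ZS"
proof
  show "{#} \<in> ZS" by (simp add: ZS_def)
next
  fix x y assume "x \<in> ZS" "y \<in> ZS"
  then show "x + y \<in> ZS" by (simp add: ZS_def \<sigma>_union)
next
  fix x y assume "x \<in> ZS" "x + y \<in> ZS"
  then show "y \<in> ZS" using \<sigma>_union[of x y] by (auto simp: ZS_def)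
qed

sublocale saturated_msets ZS by (rule saturated_ZS)

lemma singleton_ZS_iff: "{#p#} \<in> ZS \<longleftrightarrow> p \<in> P \<and> c p = \<one>"
  by (auto simp: ZS_def \<sigma>_add_mset)

lemma pair_ZS_iff: "{#p, q#} \<in> ZS \<longleftrightarrow> p \<in> P \<and> q \<in> P \<and> c p \<otimes> c q = \<one>"
  by (auto simp: ZS_def \<sigma>_add_mset)

lemma atom_no_identity:
  assumes "u \<in> mset_atoms ZS" "size u \<ge> 2" "p \<in># u"
  shows "c p \<noteq> \<one>"
proof
  assume "c p = \<one>"
  then have "{#p#} \<in> ZS"
    using assms(3) ZS_subset[OF mset_atomsD(1)[OF assms(1)]] by (auto simp: singleton_ZS_iff)
  with mset_atom_eqI[OF assms(1) this] assms(3) have "{#p#} = u" by simp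
  with assms(2) show False by auto
qed

text \<open>
  A decomposition of the merged multiset has one part without \<open>s\<close>, and this part already is a
  zero-sum part of the given atom.
\<close>

lemma merge_atom:
  assumes "add_mset p (add_mset q w) \<in> mset_atoms ZS" "s \<in> P" "c s = c p \<otimes> c q"
  shows "add_mset s w \<in> mset_atoms ZS"
proof (rule atomI)
  let ?v = "add_mset p (add_mset q w)"
  have v: "?v \<in> ZS" using assms(1) by (rule mset_atomsD(1))
  have P: "p \<in> P" "q \<in> P" "set_mset w \<subseteq> P" using ZS_subset[OF v] by auto
  have "c p \<otimes> (c q \<otimes> \<sigma> w) = \<one>" using P ZS_\<sigma>[OF v] by (simp add: \<sigma>_add_mset)
  then show "add_mset s w \<in> ZS" 
    using P assms(2,3) unfolding ZS_def by (simp add: \<sigma>_add_mset m_assoc)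
  have *: "y = {#}" if xy: "x \<in> ZS" "y \<in> ZS" "add_mset s w = x + y" "s \<in># x" for x y
  proof -
    obtain x' where "x = add_mset s x'" using xy(4) by (metis multi_member_split)
    then have w: "w = x' + y" using xy(3) by simp
    then have "y \<subseteq># w" by simp
    moreover have "w \<subseteq># ?v" by (rule mset_subset_eqI) simp
    ultimately have "y \<subseteq># ?v" "y \<noteq> ?v"
      using size_mset_mono[of y w] by (auto intro: subset_mset.order_trans)
    then show ?thesis using mset_atomsD(3)[OF assms(1) xy(2)] by blast
  qed
  fix x y assume "x \<in> ZS" "y \<in> ZS" "add_mset s w = x + y"
  moreover from this have "s \<in># x + y" by (metis union_single_eq_member)
  ultimately show "x = {#} \<or> y = {#}" 
    using *[of x y] *[of y x] by (metis add.commute union_iff)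
qed simp

lemma atom_of_smaller_size:
  assumes "u \<in> mset_atoms ZS" "1 \<le> n" "n \<le> size u"
  obtains v where "v \<in> mset_atoms ZS" "size v = n"
proof -
  have "\<exists>v\<in>mset_atoms ZS. size v = n"
    using assms
  proof (induction "size u" arbitrary: u rule: less_induct)
    case less
    show ?case
    proof (cases "size u = n")
      case False
      with less.prems have "2 \<le> size u" by simp
      then obtain p q w where u: "u = add_mset p (add_mset q w)" by (rule size_ge_2E)
      then have "p \<in> P" "q \<in> P"
        using ZS_subset[OF mset_atomsD(1)[OF less.prems(1)]] by auto
      then obtain s where s: "s \<in> P" "c s = c p \<otimes> c q" 
        using obtain_prime[of "c p \<otimes> c q"] by auto
      have "add_mset s w \<in> mset_atoms ZS" 
        by (rule merge_atom[OF less.prems(1)[unfolded u] s])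
      moreover have "size (add_mset s w) < size u" "n \<le> size (add_mset s w)"
        using u False less.prems by simp_all
      ultimately show ?thesis using less.hyps less.prems(2) by blast
    qed (use less.prems in auto)
  qed
  with that show thesis by blast
qed

text \<open>
  The converse of merging: at most two atoms cover \<open>p\<close> and \<open>q\<close>, and what remains is a zero-sum
  part of the atom that does not reach \<open>s\<close>, hence empty.
\<close>

lemma facts_of_split_atom:
  assumes "add_mset s t \<in> mset_atoms ZS" "g \<in> mset_facts ZS (add_mset p (add_mset q t))"
  shows "size g \<le> 2"
proof -
  have "add_mset p (add_mset q t) = {#p, q#} + t" by simp
  then obtain y where y: "y \<subseteq># g" "size y \<le> size {#p, q#}" "\<Sum>\<^sub># (g - y) \<subseteq># t"
    using facts_cover[of g ZS "{#p, q#}" t] assms(2) by metis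
  have facts: "g - y \<in> mset_facts ZS (\<Sum>\<^sub># (g - y))"
    by (rule mset_facts_subset[OF assms(2)]) simp
  have "\<Sum>\<^sub># (g - y) \<subseteq># add_mset s t" "\<Sum>\<^sub># (g - y) \<noteq> add_mset s t"
    using y(3) size_mset_mono[OF y(3)] by (auto intro: subset_mset.order_trans)
  then have "\<Sum>\<^sub># (g - y) = {#}"
    using mset_atomsD(3)[OF assms(1)] facts_closed[OF facts] by blast
  then have "g - y = {#}" using facts mset_facts_empty by metis
  then have "g = y" using y(1) by (metis subset_mset.add_diff_inverse add.right_neutral)
  then show ?thesis using y(2) by simp
qed

end

section \<open>Tame degrees up to the Davenport constant\<close>

context class_map
begin

lemma neg_image:
  obtains \<nu> where "\<And>p. p \<in> P \<Longrightarrow> \<nu> p \<in> P \<and> c (\<nu> p) = inv c p"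
proof -
  have "\<exists>q. q \<in> P \<and> c q = inv c p" if "p \<in> P" for p
    using obtain_prime[of "inv c p"] that by (metis c_closed inv_closed)
  then have "\<And>p. p \<in> P \<Longrightarrow> (SOME q. q \<in> P \<and> c q = inv c p) \<in> P \<and>
      c (SOME q. q \<in> P \<and> c q = inv c p) = inv c p"
    by (rule someI_ex)
  then show thesis by (rule that)
qed

text \<open>
  With \<open>V\<close> consisting of primes in the classes inverse to those of \<open>U\<close>, the only factorization
  of \<open>U + V\<close> containing \<open>U\<close> is \<open>{#U, V#}\<close>. It has no atom in common with the factorization into
  pairs \<open>{#p, \<nu> p#}\<close>, since the atoms \<open>U\<close> and \<open>V\<close> have size at least 3. As no factor has size 1,
  there are at most \<open>n\<close> atoms in any factorization of \<open>U + V\<close>, so no larger distance occurs.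
\<close>

lemma size_atom_in_Ta:
  assumes U: "U \<in> mset_atoms ZS" and n: "size U = n" "3 \<le> n"
  shows "enat n \<in> mset_Ta ZS"
proof -
  obtain \<nu> where \<nu>: "\<And>p. p \<in> P \<Longrightarrow> \<nu> p \<in> P \<and> c (\<nu> p) = inv c p" using neg_image by blast
  define V where "V = image_mset \<nu> U"
  have UP: "set_mset U \<subseteq> P" using U ZS_subset mset_atomsD(1) by blast
  have c1: "c p \<noteq> \<one>" if "p \<in># U" for p using atom_no_identity[OF U _ that] n by simp
  have \<sigma>\<nu>: "set_mset (image_mset \<nu> S) \<subseteq> P \<and> \<sigma> (image_mset \<nu> S) = inv \<sigma> S"
    if "set_mset S \<subseteq> P" for S
    using that by (induction S) (auto simp: \<sigma>_add_mset \<nu> inv_mult)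
  have ZS\<nu>: "image_mset \<nu> S \<in> ZS \<longleftrightarrow> S \<in> ZS" if S: "set_mset S \<subseteq> P" for S
  proof -
    have "inv \<sigma> S = \<one> \<longleftrightarrow> \<sigma> S = \<one>" using \<sigma>_closed[OF S] by (simp add: inv_eq_1_iff)
    then show ?thesis using \<sigma>\<nu>[OF S] S unfolding ZS_def by simp
  qed
  have V: "V \<in> mset_atoms ZS"
  proof (rule atomI)
    show "V \<in> ZS" unfolding V_def using ZS\<nu>[OF UP] mset_atomsD(1)[OF U] by simp
    show "V \<noteq> {#}" unfolding V_def using mset_atomsD(2)[OF U] by simp
    fix x y assume xy: "x \<in> ZS" "y \<in> ZS" "V = x + y"
    then obtain x' y' where *: "U = x' + y'" "x = image_mset \<nu> x'" "y = image_mset \<nu> y'"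
      unfolding V_def by (blast dest: image_mset_eq_plusD)
    then have "x' \<in> ZS" using ZS\<nu>[of x'] UP xy(1) by simp
    moreover have "x' \<subseteq># U" unfolding *(1) by simp
    ultimately have "x' = {#} \<or> x' = U" using mset_atomsD(3)[OF U] by blast
    then show "x = {#} \<or> y = {#}" using * by auto
  qed
  have sV: "size V = n" unfolding V_def using n by simp
  define z where "z = image_mset (\<lambda>p. {#p, \<nu> p#}) U"
  have z: "z \<in> mset_facts ZS (U + V)"
  proof -
    have "{#p, \<nu> p#} \<in> mset_atoms ZS" if p: "p \<in># U" for p
    proof (rule pair_atom)
      have pP: "p \<in> P" using p UP by auto
      then show "{#p, \<nu> p#} \<in> ZS" using \<nu> by (simp add: pair_ZS_iff)
      show "{#p#} \<notin> ZS" using c1[OF p] by (simp add: singleton_ZS_iff)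
      show "{#\<nu> p#} \<notin> ZS" using c1[OF p] \<nu>[OF pP] pP by (simp add: singleton_ZS_iff inv_eq_1_iff)
    qed
    then show ?thesis unfolding mset_facts_def z_def V_def by (auto simp: sum_mset_pairs)
  qed
  have only: "z' = {#U, V#}" if z': "z' \<in> mset_facts ZS (U + V)" "U \<in># z'" for z'
  proof -
    have "z' - {#U#} \<in> mset_facts ZS V"
      using mset_facts_diff[OF z'(1), of "{#U#}"] z'(2) mset_facts_single[OF U] by simp
    then have "z' - {#U#} = {#V#}" by (rule facts_of_atom[OF V])
    then show ?thesis using z'(2) by (metis insert_DiffM)
  qed
  have UV: "{#U, V#} \<in> mset_facts ZS (U + V)" using U V unfolding mset_facts_def by simp
  have half: "size y \<le> n" if "y \<in> mset_facts ZS (U + V)" for y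
  proof -
    have "{#p#} \<notin> ZS" if "p \<in># U + V" for p
      using that c1 UP \<nu> by (auto simp: V_def singleton_ZS_iff inv_eq_1_iff)
    then have "2 * size y \<le> size (U + V)" by (rule size_mset_facts_le_half[OF that])
    then show ?thesis using n sV by simp
  qed
  show ?thesis
  proof (rule mset_TaI[of n "U + V" ZS U z])
    show "0 < n" using n by simp
    show "U + V \<in> ZS" using union_closed mset_atomsD(1)[OF U] mset_atomsD(1)[OF V] by blast
    fix y assume y: "y \<in> mset_facts ZS (U + V)"
    have "fact_dist y {#U, V#} \<le> n" using fact_dist_le[of y "{#U, V#}"] half[OF y] n by simp
    then show "\<exists>z'\<in>mset_facts ZS (U + V). U \<in># z' \<and> fact_dist y z' \<le> n"
      using UV by (intro bexI[of _ "{#U, V#}"]) simp_all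
  next
    fix z' assume "z' \<in> mset_facts ZS (U + V)" "U \<in># z'"
    then have z': "z' = {#U, V#}" by (rule only)
    have "U \<notin># z" "V \<notin># z" using n sV unfolding z_def by auto
    then have "z \<inter># z' = {#}" unfolding z' by simp
    then show "n \<le> fact_dist z z'" using n by (simp add: fact_dist_disjoint z_def)
  qed (use U z in simp_all)
qed

text \<open>
  Split \<open>V = {#x, y#} + Y\<close> and let \<open>p\<close>, \<open>p'\<close> be primes in the inverse classes of the product of
  \<open>Y\<close> and of \<open>{#x, y#}\<close>. Then \<open>V + {#p, p'#}\<close> also is the sum of \<open>{#x, y, p'#}\<close> and \<open>Y + {#p#}\<close>,
  neither of which contains \<open>V\<close>. At most two atoms of a factorization cover \<open>p\<close> and \<open>p'\<close>; as \<open>V\<close>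
  is an atom, the others sum to nothing or to \<open>V\<close>, and in the latter case \<open>{#p, p'#}\<close> is the
  only other atom.
\<close>

lemma two_in_Ta_of_large_atom:
  assumes V: "V \<in> mset_atoms ZS" and n: "4 \<le> size V"
  shows "2 \<in> mset_Ta ZS"
proof -
  obtain x y Y where V_eq: "V = add_mset x (add_mset y Y)" using size_ge_2E[of V] n by auto
  have sY: "2 \<le> size Y" using n V_eq by simp
  have VZ: "V \<in> ZS" using V by (rule mset_atomsD(1))
  have P: "x \<in> P" "y \<in> P" "set_mset Y \<subseteq> P" using ZS_subset[OF VZ] V_eq by auto
  have V1: "c x \<otimes> (c y \<otimes> \<sigma> Y) = \<one>" using ZS_\<sigma>[OF VZ] P V_eq by (simp add: \<sigma>_add_mset)
  obtain p where p: "p \<in> P" "c p = c x \<otimes> c y" using obtain_prime[of "c x \<otimes> c y"] P by auto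
  obtain p' where p': "p' \<in> P" "c p' = \<sigma> Y" using obtain_prime[of "\<sigma> Y"] P by auto
  have p1: "c p \<noteq> \<one>"
  proof
    assume "c p = \<one>"
    then have "{#x, y#} \<in> ZS" using P p by (simp add: pair_ZS_iff)
    then have "{#x, y#} = V" by (rule mset_atom_eqI[OF V]) (simp_all add: V_eq)
    from this[symmetric] n show False by simp
  qed
  have pp': "c p \<otimes> c p' = \<one>" using V1 p p' P by (simp add: m_assoc)
  have p'1: "c p' \<noteq> \<one>" using pp' p1 p p' by (metis c_closed r_one)
  have W: "{#p, p'#} \<in> mset_atoms ZS"
    using pp' p1 p'1 p(1) p'(1) by (intro pair_atom) (simp_all add: pair_ZS_iff singleton_ZS_iff)
  have A: "{#x, y, p'#} \<in> ZS"
    using P p p' pp' unfolding ZS_def by (simp add: \<sigma>_add_mset m_assoc)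
  have C: "add_mset p Y \<in> ZS"
    using P p p' pp' unfolding ZS_def by (simp add: \<sigma>_add_mset)
  obtain z1 where z1: "z1 \<in> mset_facts ZS {#x, y, p'#}" using facts_exist[OF A] by blast
  obtain z2 where z2: "z2 \<in> mset_facts ZS (add_mset p Y)" using facts_exist[OF C] by blast
  define a where "a = {#p, p'#} + V"
  have a: "a = {#x, y, p'#} + add_mset p Y" unfolding a_def V_eq by simp
  have small: "V \<notin># z" if z: "z \<in> mset_facts ZS b" and "size b < size V" for z b
  proof
    assume "V \<in># z"
    then obtain z' where "z = add_mset V z'" by (metis multi_member_split)
    then have "b = V + \<Sum>\<^sub># z'" using z unfolding mset_facts_def by auto
    with that(2) show False by simp
  qed
  show ?thesis
  proof (rule tame_eq_2I[OF _ V])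
    show "a \<in> ZS" unfolding a_def using union_closed mset_atomsD(1) W V by blast
    show "V \<subseteq># a" unfolding a_def by simp
    show "z1 + z2 \<in> mset_facts ZS a" unfolding a using z1 z2 by (rule mset_facts_add)
    show "V \<notin># z1 + z2" using small[OF z1] small[OF z2] n sY V_eq by simp
    fix z assume z: "z \<in> mset_facts ZS a"
    then obtain w where w: "w \<subseteq># z" "size w \<le> size {#p, p'#}"
        "\<Sum>\<^sub># w + \<Sum>\<^sub># (z - w) = {#p, p'#} + V" "\<Sum>\<^sub># (z - w) \<subseteq># V"
      unfolding a_def by (rule facts_cover)
    have facts: "z - w \<in> mset_facts ZS (\<Sum>\<^sub># (z - w))"
      by (rule mset_facts_subset[OF z]) simp
    have zw: "size z = size w + size (z - w)"
      using w(1) by (metis size_union subset_mset.add_diff_inverse)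
    consider "\<Sum>\<^sub># (z - w) = {#}" | "\<Sum>\<^sub># (z - w) = V"
      using mset_atomsD(3)[OF V facts_closed[OF facts] w(4)] by blast
    then show "size z \<le> 2"
    proof cases
      case 1
      then have "z - w = {#}" using facts mset_facts_empty by metis
      then show ?thesis using w(2) zw by simp
    next
      case 2
      then have "z - w = {#V#}" using facts facts_of_atom[OF V] by metis
      moreover have "\<Sum>\<^sub># w = {#p, p'#}" using w(3) unfolding 2 by (rule add_right_imp_eq)
      then have "w \<in> mset_facts ZS {#p, p'#}"
        using mset_facts_subset[OF z w(1)] by (simp only:)
      then have "w = {#{#p, p'#}#}" by (rule facts_of_atom[OF W])
      ultimately show ?thesis using zw by simp
    qed
  qed
qed

text \<open>
  Exchanging \<open>p\<close> and \<open>q\<close> in \<open>{#p, r#} + {#q, k', l#}\<close>, where the classes of \<open>r\<close>, \<open>k'\<close>, \<open>l\<close> are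
  nontrivial and make both parts zero-sum, gives a different factorization. The five primes
  involved have nontrivial classes, so all factorizations have at most two atoms.
\<close>

lemma two_in_Ta_of_two_primes:
  assumes pq: "p \<in> P" "q \<in> P" "p \<noteq> q" "c p = g" "c q = g" "g \<noteq> \<one>"
    and k: "k \<in> carrier G" "k \<noteq> \<one>" "k \<noteq> inv g"
  shows "2 \<in> mset_Ta ZS"
proof -
  have g: "g \<in> carrier G" using pq by auto
  obtain r where r: "r \<in> P" "c r = inv g" using obtain_prime[of "inv g"] g by auto
  obtain k' where k': "k' \<in> P" "c k' = k" using obtain_prime[of k] k by auto
  obtain l where l: "l \<in> P" "c l = inv (g \<otimes> k)" using obtain_prime[of "inv (g \<otimes> k)"] g k by auto
  have l1: "c l \<noteq> \<one>"
  proof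
    assume "c l = \<one>"
    then have "g \<otimes> k = \<one>" using l g k by (simp add: inv_eq_1_iff)
    then have "k \<otimes> g = \<one>" using g k m_comm by metis
    then have "k = inv g" using g k inv_equality by metis
    with k show False by simp
  qed
  have r1: "c r \<noteq> \<one>" using r g pq by (simp add: inv_eq_1_iff)
  have pair: "{#s, r#} \<in> mset_atoms ZS" if "s \<in> P" "c s = g" for s
    using that r g pq(6) r1 by (intro pair_atom) (simp_all add: pair_ZS_iff singleton_ZS_iff)
  define b where "b = {#q, k', l#}"
  have b: "b \<in> ZS"
  proof -
    have "g \<otimes> (k \<otimes> inv (g \<otimes> k)) = (g \<otimes> k) \<otimes> inv (g \<otimes> k)"
      using g k by (intro m_assoc[symmetric]) auto
    also have "\<dots> = \<one>" using g k by (intro r_inv m_closed)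
    finally show ?thesis using pq k' l g k unfolding b_def ZS_def by (simp add: \<sigma>_add_mset)
  qed
  have no1: "{#s#} \<notin> ZS" if "s \<in># {#p, r#} + b" for s
    using that r1 l1 pq k' k unfolding b_def by (auto simp: singleton_ZS_iff)
  obtain z2 where z2: "z2 \<in> mset_facts ZS b" using facts_exist[OF b] by blast
  have u_z2: "{#q, r#} \<notin># z2"
  proof
    assume "{#q, r#} \<in># z2"
    then obtain z' where z': "z2 = add_mset {#q, r#} z'" by (metis multi_member_split)
    then have rest: "b = {#q, r#} + \<Sum>\<^sub># z'" using z2 unfolding mset_facts_def by auto
    have "size b = 2 + size (\<Sum>\<^sub># z')" unfolding rest by simp
    then have "size (\<Sum>\<^sub># z') = 1" unfolding b_def by simp
    then obtain s where s: "\<Sum>\<^sub># z' = {#s#}" using size_1_singleton_mset by blast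
    have "z' \<in> mset_facts ZS {#s#}"
      using mset_facts_subset[OF z2, of z'] s z' by simp
    then have "{#s#} \<in> ZS" by (rule facts_closed)
    moreover have "s \<in># {#p, r#} + b" unfolding rest s by simp
    ultimately show False using no1 by blast
  qed
  show ?thesis
  proof (rule tame_eq_2I[of "{#p, r#} + b" "{#q, r#}"])
    show "{#p, r#} + b \<in> ZS" using union_closed mset_atomsD(1) pair pq b by blast
    show "{#q, r#} \<in> mset_atoms ZS" using pair pq by blast
    show "{#q, r#} \<subseteq># {#p, r#} + b" unfolding b_def by simp
    show "{#{#p, r#}#} + z2 \<in> mset_facts ZS ({#p, r#} + b)"
      using mset_facts_single pair pq z2 by (intro mset_facts_add) blast+
    show "{#q, r#} \<notin># {#{#p, r#}#} + z2" using u_z2 pq(3) by simp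
    fix z assume "z \<in> mset_facts ZS ({#p, r#} + b)"
    then have "2 * size z \<le> size ({#p, r#} + b)" using no1 by (rule size_mset_facts_le_half)
    then show "size z \<le> 2" by (simp add: b_def)
  qed
qed

text \<open>
  For an atom containing \<open>x\<close>, \<open>y\<close> and something else, \<open>\<one>\<close>, \<open>c x\<close> and \<open>c x \<otimes> c y\<close> are distinct.
\<close>

lemma obtain_third_class:
  assumes U: "U \<in> mset_atoms ZS" "3 \<le> size U" and "h \<in> carrier G"
  obtains k where "k \<in> carrier G" "k \<noteq> \<one>" "k \<noteq> h"
proof -
  obtain x y w where U_eq: "U = add_mset x (add_mset y w)" using size_ge_2E[of U] U by auto
  have P: "x \<in> P" "y \<in> P" using ZS_subset[OF mset_atomsD(1)[OF U(1)]] U_eq by auto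
  have xy1: "c x \<noteq> \<one>" "c y \<noteq> \<one>" using atom_no_identity[OF U(1)] U(2) U_eq by auto
  have "c x \<otimes> c y \<noteq> \<one>"
  proof
    assume "c x \<otimes> c y = \<one>"
    then have "{#x, y#} \<in> ZS" using P by (simp add: pair_ZS_iff)
    then have "{#x, y#} = U" by (rule mset_atom_eqI[OF U(1)]) (simp_all add: U_eq)
    from this[symmetric] U(2) show False by simp
  qed
  moreover have "c x \<otimes> c y \<noteq> c x" using P xy1 by simp
  ultimately show thesis
    using that[of "c x"] that[of "c x \<otimes> c y"] P xy1(1) by (metis c_closed m_closed)
qed

end

section \<open>Tame degrees above the Davenport constant\<close>

context class_map
begin

text \<open>
  The element \<open>a\<close> is chosen of smallest size among those with a tame degree of at least \<open>M\<close>. The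
  proof shows that a degree larger than \<open>M\<close> would survive, diminished by at most 1, in a smaller
  element. The condition \<open>fresh\<close> provides the prime \<open>s\<close> outside of \<open>u\<close> that makes this work.
\<close>

lemma Ta_above_davenport:
  assumes D: "\<And>u. u \<in> mset_atoms ZS \<Longrightarrow> size u \<le> D" and M: "D < M"
    and fresh: "\<And>g F. g \<in> carrier G \<Longrightarrow> finite F \<Longrightarrow> card F \<le> D \<Longrightarrow> \<exists>s\<in>P - F. c s = g"
    and ex: "a0 \<in> ZS" "u0 \<in> mset_atoms ZS" "enat M \<le> mset_tame ZS a0 u0"
  shows "enat M \<in> mset_Ta ZS"
proof -
  define Q where "Q a \<longleftrightarrow> a \<in> ZS \<and> (\<exists>u\<in>mset_atoms ZS. enat M \<le> mset_tame ZS a u)" for a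
  have "Q a0" using ex unfolding Q_def by blast
  then obtain a where a: "Q a" and min: "\<And>b. Q b \<Longrightarrow> size a \<le> size b"
    using ex_has_least_nat[of Q a0 size] by blast
  obtain u where aZ: "a \<in> ZS" and u: "u \<in> mset_atoms ZS" and tame: "enat M \<le> mset_tame ZS a u"
    using a unfolding Q_def by blast
  have M0: "0 < M" using M by simp
  obtain z0 where "z0 \<in> mset_facts ZS a" "u \<in># z0"
    using tame le_mset_tame_iff[OF M0] by blast
  then have ua: "u \<subseteq># a" unfolding mset_facts_def by (auto dest: multi_member_split)
  have "mset_tame ZS a u \<le> enat M"
  proof (rule ccontr)
    assume "\<not> ?thesis"
    then have "enat (Suc M) \<le> mset_tame ZS a u" by (simp add: Suc_ile_eq)
    then obtain z where z: "z \<in> mset_facts ZS a"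
      and far: "\<And>z'. z' \<in> mset_facts ZS a \<Longrightarrow> u \<in># z' \<Longrightarrow> Suc M \<le> fact_dist z z'"
      using le_mset_tame_iff[of "Suc M" ZS a u] by auto
    have za: "\<Sum>\<^sub># z = a" and zat: "set_mset z \<subseteq> mset_atoms ZS" using z unfolding mset_facts_def by auto
    \<comment> \<open>A proper part of \<open>z\<close> that still covers \<open>u\<close> would be as far from all factorizations containing
      \<open>u\<close>, contrary to the choice of \<open>a\<close>.\<close>
    have minimal: "y = z" if y: "y \<subseteq># z" "u \<subseteq># \<Sum>\<^sub># y" for y
    proof (rule ccontr)
      assume "y \<noteq> z"
      define r where "r = z - y"
      have zr: "z = y + r" using y(1) unfolding r_def by simp
      have "r \<noteq> {#}" using \<open>y \<noteq> z\<close> zr by auto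
      have yf: "y \<in> mset_facts ZS (\<Sum>\<^sub># y)" by (rule mset_facts_subset[OF z y(1)])
      have rf: "r \<in> mset_facts ZS (\<Sum>\<^sub># r)" by (rule mset_facts_subset[OF z]) (simp add: zr)
      have a_eq: "a = \<Sum>\<^sub># y + \<Sum>\<^sub># r" using za zr by simp
      have "Q (\<Sum>\<^sub># y)"
      proof -
        obtain f where f: "add_mset u f \<in> mset_facts ZS (\<Sum>\<^sub># y)"
          using facts_with_exist[OF facts_closed[OF yf] u y(2)] by blast
        have "M \<le> fact_dist y y'" if "y' \<in> mset_facts ZS (\<Sum>\<^sub># y)" "u \<in># y'" for y'
        proof -
          have "y' + r \<in> mset_facts ZS a" unfolding a_eq by (rule mset_facts_add[OF that(1) rf])
          then have "Suc M \<le> fact_dist (r + y) (r + y')"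
            using far[of "y' + r"] that(2) by (simp add: zr add.commute)
          then show ?thesis by (simp add: fact_dist_add)
        qed
        then have "enat M \<le> mset_tame ZS (\<Sum>\<^sub># y) u"
          unfolding le_mset_tame_iff[OF M0] using f yf by (metis union_single_eq_member)
        then show ?thesis using facts_closed[OF yf] u unfolding Q_def by blast
      qed
      then have "size a \<le> size (\<Sum>\<^sub># y)" by (rule min)
      moreover have "0 < size r" using \<open>r \<noteq> {#}\<close> by (simp add: nonempty_has_size)
      then have "0 < size (\<Sum>\<^sub># r)" using size_mset_facts_le[OF rf] by linarith
      ultimately show False unfolding a_eq size_union by linarith
    qed
    have zD: "size z \<le> D"
    proof -
      obtain y where "y \<subseteq># z" "u \<subseteq># \<Sum>\<^sub># y" "size y \<le> size u"
        using subset_mset_sum_cover[of u z] ua za by auto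
      then show ?thesis using minimal D[OF u] by fastforce
    qed
    define b where "b = a - u"
    have ab: "a = u + b" unfolding b_def using ua by simp
    have bZ: "b \<in> ZS" unfolding b_def by (rule diff_closed[OF ua mset_atomsD(1)[OF u] aZ])
    \<comment> \<open>Since \<open>z\<close> has at most \<open>D\<close> atoms and \<open>D < M\<close>, the distance from \<open>z\<close> to a factorization containing
      \<open>u\<close> can exceed \<open>M\<close> only through the length of the latter.\<close>
    have long: "M \<le> size f" if f: "f \<in> mset_facts ZS b" for f
    proof -
      have "add_mset u f \<in> mset_facts ZS a"
        using mset_facts_add[OF mset_facts_single[OF u] f] unfolding ab by simp
      then have "Suc M \<le> fact_dist z (add_mset u f)" by (intro far) simp_all
      then show ?thesis using fact_dist_le[of z "add_mset u f"] zD M by simp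
    qed
    have "M \<le> size b" using facts_exist[OF bZ] long size_mset_facts_le order_trans by metis
    \<comment> \<open>There is room for merging: \<open>b\<close> has more primes than \<open>z\<close> has atoms.\<close>
    have "\<exists>v\<in>#z. 2 \<le> size (v \<inter># b)"
    proof (rule ccontr)
      assume "\<not> ?thesis"
      then have "size (v \<inter># b) \<le> 1" if "v \<in># z" for v using that by fastforce
      moreover have "b \<subseteq># \<Sum>\<^sub># z" unfolding za ab by simp
      ultimately have "size b \<le> size z" using size_le_if_inter_le_1 by blast
      with zD M \<open>M \<le> size b\<close> show False by simp
    qed
    then obtain v where v: "v \<in># z" "2 \<le> size (v \<inter># b)" by blast
    obtain p q r where pqr: "v \<inter># b = add_mset p (add_mset q r)" using v(2) by (rule size_ge_2E)
    have "{#p, q#} \<subseteq># v \<inter># b" unfolding pqr by simp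
    then have "{#p, q#} \<subseteq># v" "{#p, q#} \<subseteq># b" by simp_all
    then obtain w e where w: "v = {#p, q#} + w" and e: "b = {#p, q#} + e"
      by (metis subset_mset.le_iff_add)
    obtain y where y: "z = add_mset v y" using v(1) by (metis multi_member_split)
    have vat: "v \<in> mset_atoms ZS" using zat v(1) by blast
    have pq: "p \<in> P" "q \<in> P" using ZS_subset[OF mset_atomsD(1)[OF vat]] w by auto
    have "\<exists>s\<in>P - set_mset u. c s = c p \<otimes> c q"
    proof (rule fresh)
      have "card (set_mset u) \<le> size u"
        by (metis card_eq_sum count_greater_zero_iff Suc_leI One_nat_def size_multiset_overloaded_eq sum_mono)
      then show "card (set_mset u) \<le> D" using D[OF u] by linarith
    qed (use pq in auto)
    then obtain s where s: "s \<in> P" "s \<notin># u" "c s = c p \<otimes> c q" by auto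
    define v' where "v' = add_mset s w"
    have v'at: "v' \<in> mset_atoms ZS"
      unfolding v'_def by (rule merge_atom[OF _ s(1,3)]) (use vat w in simp)
    define z1 where "z1 = add_mset v' y"
    have wy: "w + \<Sum>\<^sub># y = u + e"
    proof -
      have "{#p, q#} + (w + \<Sum>\<^sub># y) = {#p, q#} + (u + e)"
        using za ab unfolding y w e by (simp add: ac_simps)
      then show ?thesis by (rule add_left_imp_eq)
    qed
    define a1 where "a1 = u + add_mset s e"
    have z1a1: "\<Sum>\<^sub># z1 = a1" unfolding z1_def v'_def a1_def using wy by simp
    have z1: "z1 \<in> mset_facts ZS a1"
      using z1a1 v'at zat unfolding mset_facts_def z1_def y by simp
    \<comment> \<open>The minimality of \<open>z\<close> passes to \<open>z1\<close>, as the new prime \<open>s\<close> does not help to cover \<open>u\<close>.\<close>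
    have not_cover: "\<not> u \<subseteq># \<Sum>\<^sub># (z1 - {#x#})" if x: "x \<in># z1" for x
    proof
      assume *: "u \<subseteq># \<Sum>\<^sub># (z1 - {#x#})"
      show False
      proof (cases "x = v'")
        case True
        then have "u \<subseteq># \<Sum>\<^sub># y" using * unfolding z1_def by simp
        then have "y = z" by (intro minimal) (simp_all add: y)
        then show False unfolding y by simp
      next
        case False
        then obtain y' where y': "y = add_mset x y'"
          using x unfolding z1_def by (auto dest: multi_member_split)
        then have "z1 - {#x#} = add_mset v' y'" unfolding z1_def by simp
        then have "u \<subseteq># add_mset s (w + \<Sum>\<^sub># y')" using * unfolding v'_def by simp
        then have "u \<subseteq># w + \<Sum>\<^sub># y'" using s(2) by (auto elim: subset_add_mset_cases)
        moreover have "w + \<Sum>\<^sub># y' \<subseteq># \<Sum>\<^sub># (add_mset v y')" unfolding w by simp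
        ultimately have "u \<subseteq># \<Sum>\<^sub># (add_mset v y')" by (rule subset_mset.order_trans)
        then have "add_mset v y' = z" by (intro minimal) (simp_all add: y y')
        then show False unfolding y y' by simp
      qed
    qed
    \<comment> \<open>Splitting \<open>s\<close> again turns a factorization of \<open>a1 - u\<close> into one of \<open>b\<close> with at most one more atom,
      so \<open>z'\<close> has at least \<open>M\<close> atoms. It has none in common with \<open>z1\<close>, since such an atom could be removed
      from \<open>z1\<close> without uncovering \<open>u\<close>.\<close>
    have far1: "M \<le> fact_dist z1 z'" if z': "z' \<in> mset_facts ZS a1" "u \<in># z'" for z'
    proof -
      obtain f where f: "z' = add_mset u f" using z'(2) by (metis multi_member_split)
      have sumf: "\<Sum>\<^sub># f = add_mset s e" using z'(1) unfolding mset_facts_def f a1_def by simp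
      have fat: "set_mset f \<subseteq> mset_atoms ZS" using z'(1) unfolding mset_facts_def f by simp
      obtain t where t: "t \<in># f" "s \<in># t" using sumf by (metis in_Union_mset_iff union_single_eq_member)
      obtain f' t' where f': "f = add_mset t f'" and t': "t = add_mset s t'"
        using t by (metis multi_member_split)
      have tat: "add_mset s t' \<in> mset_atoms ZS" using fat t(1) t' by auto
      have e_eq: "e = t' + \<Sum>\<^sub># f'" using sumf unfolding f' t' by simp
      have f'f: "f' \<in> mset_facts ZS (\<Sum>\<^sub># f')" using fat unfolding f' mset_facts_def by simp
      have split: "add_mset p (add_mset q t') \<in> ZS"
      proof -
        have tZ: "add_mset s t' \<in> ZS" using tat by (rule mset_atomsD(1))
        then have "set_mset t' \<subseteq> P" using ZS_subset by force
        then show ?thesis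
          using tZ pq s unfolding ZS_def by (simp add: \<sigma>_add_mset m_assoc)
      qed
      then obtain g where g: "g \<in> mset_facts ZS (add_mset p (add_mset q t'))" using facts_exist by blast
      have "size g \<le> 2" by (rule facts_of_split_atom[OF tat g])
      have "g + f' \<in> mset_facts ZS b"
        using mset_facts_add[OF g f'f] unfolding e e_eq by simp
      then have "M \<le> size g + size f'" using long by fastforce
      then have size: "M \<le> size z'" using \<open>size g \<le> 2\<close> unfolding f f' by simp
      have "z1 \<inter># z' = {#}"
      proof (rule ccontr)
        assume "z1 \<inter># z' \<noteq> {#}"
        then obtain x where x: "x \<in># z1" "x \<in># z'"
          unfolding disjunct_not_in by blast
        have "u \<subseteq># \<Sum>\<^sub># (z1 - {#x#})"
        proof (cases "x = u")
          case True
          have "u \<noteq> v'" using s(2) unfolding v'_def by auto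
          moreover have "u \<in># add_mset v' y" using x(1) True unfolding z1_def by blast
          ultimately have "u \<in># y" by simp
          then obtain y' where "y = add_mset u y'" by (metis multi_member_split)
          then have "u \<subseteq># \<Sum>\<^sub># (z1 - {#v'#})" unfolding z1_def by simp
          then show ?thesis using not_cover[of v'] unfolding z1_def by simp
        next
          case False
          then have "x \<in># f" using x(2) unfolding f by simp
          then obtain f2 where f2: "f = add_mset x f2" by (metis multi_member_split)
          have "add_mset s e = x + \<Sum>\<^sub># f2" unfolding sumf[symmetric] f2 by simp
          then have "a1 = u + (x + \<Sum>\<^sub># f2)" by (simp only: a1_def)
          moreover obtain y2 where y2: "z1 = add_mset x y2" using x(1) by (metis multi_member_split)
          then have "a1 = x + \<Sum>\<^sub># y2" using z1a1 by simp
          ultimately have "x + \<Sum>\<^sub># y2 = x + (u + \<Sum>\<^sub># f2)"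
            by (simp only: add.left_commute)
          then have "\<Sum>\<^sub># y2 = u + \<Sum>\<^sub># f2" by (rule add_left_imp_eq)
          then show ?thesis unfolding y2 by simp
        qed
        with not_cover[OF x(1)] show False by simp
      qed
      then show ?thesis using size by (simp add: fact_dist_disjoint)
    qed
    have "Q a1"
    proof -
      have a1Z: "a1 \<in> ZS" using z1 by (rule facts_closed)
      obtain f where "add_mset u f \<in> mset_facts ZS a1"
        using facts_with_exist[OF a1Z u] unfolding a1_def by auto
      then have "enat M \<le> mset_tame ZS a1 u"
        unfolding le_mset_tame_iff[OF M0] using z1 far1 by (metis union_single_eq_member)
      then show ?thesis using a1Z u unfolding Q_def by blast
    qed
    then have "size a \<le> size a1" by (rule min)
    then show False unfolding ab a1_def e by simp
  qed
  then have "mset_tame ZS a u = enat M" using tame by simp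
  then show ?thesis using aZ u M0 unfolding mset_Ta_def
    by (metis (mono_tags, lifting) CollectI enat_0 enat_ord_simps(2))
qed

end

section \<open>The Davenport constant\<close>

lemma carrier_zero_sum_monoid:
  "carrier (zero_sum_monoid G) = {S. set_mset S \<subseteq> carrier G \<and> mset_prod G S = \<one>\<^bsub>G\<^esub>}"
  by (simp add: zero_sum_monoid_def)

lemma (in comm_group) class_map_id: "class_map G (carrier G) (\<lambda>g. g)"
  by unfold_locales simp

lemma (in comm_group) ZS_id: "class_map.ZS G (carrier G) (\<lambda>g. g) = carrier (zero_sum_monoid G)"
  unfolding class_map.ZS_def[OF class_map_id] class_map.\<sigma>_def[OF class_map_id]
    carrier_zero_sum_monoid by simp

lemma (in comm_group) divisor_hom_zero_sum_monoid:
  "divisor_hom (zero_sum_monoid G) (\<lambda>S. S)"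
proof -
  interpret id: class_map G "carrier G" "\<lambda>g. g" by (rule class_map_id)
  have mult: "monoid.mult (zero_sum_monoid G) = (+)" and one: "\<one>\<^bsub>zero_sum_monoid G\<^esub> = {#}"
    by (simp_all add: zero_sum_monoid_def free_comm_monoid_def)
  have "comm_monoid (zero_sum_monoid G)"
    by (rule comm_monoidI)
      (simp_all add: mult one ac_simps id.union_closed id.empty_closed flip: ZS_id)
  then have "comm_monoid_cancel (zero_sum_monoid G)"
    by (rule comm_monoid_cancelI) (simp add: mult)
  then show ?thesis
  proof (rule divisor_hom.intro)
    show "divisor_hom_axioms (zero_sum_monoid G) (\<lambda>S. S)"
    proof
      fix S T assume "S \<in> carrier (zero_sum_monoid G)" "T \<in> carrier (zero_sum_monoid G)" "S \<subseteq># T"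
      then have "T - S \<in> carrier (zero_sum_monoid G)" "T = S + (T - S)"
        using id.diff_closed[of S T] by (simp_all add: ZS_id)
      then show "S divides\<^bsub>zero_sum_monoid G\<^esub> T" unfolding factor_def mult by blast
    qed (simp add: mult)
  qed
qed

lemma (in comm_group) Ta_zero_sum_monoid:
  "Ta (zero_sum_monoid G) = mset_Ta (carrier (zero_sum_monoid G))"
  using divisor_hom.Ta_eq[OF divisor_hom_zero_sum_monoid] by simp

lemma (in comm_group) atoms_zero_sum_monoid:
  "atoms (zero_sum_monoid G) = mset_atoms (carrier (zero_sum_monoid G))"
proof -
  have "U \<in> carrier (zero_sum_monoid G)" if "U \<in> atoms (zero_sum_monoid G)" for U
    using that by (simp add: atoms_def)
  then show ?thesis
    using divisor_hom.atom_iff[OF divisor_hom_zero_sum_monoid] mset_atomsD(1) by fastforce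
qed

context class_map
begin

text \<open>
  Zero-sum parts of the multiset of classes are exactly the classes of the zero-sum parts of
  \<open>S\<close>, so the Davenport constant of \<open>G\<close> can be computed with primes in place of group elements.
\<close>

lemma atom_iff_atom_of_classes:
  assumes S: "set_mset S \<subseteq> P"
  shows "S \<in> mset_atoms ZS \<longleftrightarrow> image_mset c S \<in> mset_atoms (carrier (zero_sum_monoid G))"
proof -
  have ZS_iff: "T \<in> ZS \<longleftrightarrow> image_mset c T \<in> carrier (zero_sum_monoid G)" if "set_mset T \<subseteq> P" for T
    using that c_onto unfolding ZS_def \<sigma>_def carrier_zero_sum_monoid by auto
  show ?thesis
  proof
    assume at: "S \<in> mset_atoms ZS"
    have "T = {#} \<or> T = image_mset c S"
      if T: "T \<in> carrier (zero_sum_monoid G)" "T \<subseteq># image_mset c S" for T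
    proof -
      obtain T' where "image_mset c S = T + T'" using T(2) by (metis subset_mset.le_iff_add)
      then obtain x y where xy: "S = x + y" "T = image_mset c x" by (blast dest: image_mset_eq_plusD)
      then have "x \<in> ZS" using ZS_iff[of x] S T(1) by simp
      moreover have "x \<subseteq># S" unfolding xy by simp
      ultimately have "x = {#} \<or> x = S" using mset_atomsD(3)[OF at] by blast
      then show ?thesis unfolding xy(2) by auto
    qed
    then show "image_mset c S \<in> mset_atoms (carrier (zero_sum_monoid G))"
      using at ZS_iff[OF S] unfolding mset_atoms_def by simp
  next
    assume at: "image_mset c S \<in> mset_atoms (carrier (zero_sum_monoid G))"
    have "x = {#} \<or> x = S" if x: "x \<in> ZS" "x \<subseteq># S" for x
    proof -
      have "image_mset c x \<in> carrier (zero_sum_monoid G)" using ZS_iff ZS_subset x(1) by blast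
      moreover have "image_mset c x \<subseteq># image_mset c S" using x(2) by (rule image_mset_subseteq_mono)
      ultimately have "image_mset c x = {#} \<or> image_mset c x = image_mset c S"
        using mset_atomsD(3)[OF at] by blast
      then have "x = {#} \<or> size x = size S" by (metis image_mset_is_empty_iff size_image_mset)
      then show ?thesis using x(2) by (metis mset_subset_size subset_mset.less_le less_irrefl)
    qed
    then show "S \<in> mset_atoms ZS"
      using at ZS_iff[OF S] unfolding mset_atoms_def by simp
  qed
qed

lemma davenport_eq: "davenport G = (SUP u\<in>mset_atoms ZS. enat (size u))"
proof -
  have "size ` atoms (zero_sum_monoid G) = size ` mset_atoms ZS"
  proof (intro subset_antisym subsetI)
    fix n assume "n \<in> size ` atoms (zero_sum_monoid G)"
    then obtain U where U: "U \<in> mset_atoms (carrier (zero_sum_monoid G))" "n = size U"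
      unfolding atoms_zero_sum_monoid by blast
    have UG: "set_mset U \<subseteq> c ` P"
      using mset_atomsD(1)[OF U(1)] unfolding carrier_zero_sum_monoid c_onto by simp
    define S where "S = image_mset (inv_into P c) U"
    have "set_mset S \<subseteq> P" using UG unfolding S_def by (auto intro: inv_into_into)
    moreover have "image_mset c S = U"
      unfolding S_def image_mset.compositionality comp_def
      using UG by (intro trans[OF image_mset_cong multiset.map_ident]) (auto simp: f_inv_into_f)
    ultimately have "S \<in> mset_atoms ZS" using atom_iff_atom_of_classes U(1) by simp
    moreover have "n = size S" unfolding S_def U(2) by simp
    ultimately show "n \<in> size ` mset_atoms ZS" by blast
  next
    fix n assume "n \<in> size ` mset_atoms ZS"
    then obtain u where u: "u \<in> mset_atoms ZS" "n = size u" by blast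
    then have "image_mset c u \<in> atoms (zero_sum_monoid G)"
      unfolding atoms_zero_sum_monoid using atom_iff_atom_of_classes ZS_subset mset_atomsD(1) by blast
    moreover have "n = size (image_mset c u)" using u by simp
    ultimately show "n \<in> size ` atoms (zero_sum_monoid G)" by blast
  qed
  then have "(\<lambda>u. enat (size u)) ` atoms (zero_sum_monoid G) = (\<lambda>u. enat (size u)) ` mset_atoms ZS"
    by (metis image_image)
  then show ?thesis unfolding davenport_def by simp
qed

lemma size_atom_le_davenport: "u \<in> mset_atoms ZS \<Longrightarrow> enat (size u) \<le> davenport G"
  unfolding davenport_eq by (rule SUP_upper)

lemma atom_of_size:
  assumes "1 \<le> n" "enat n \<le> davenport G"
  obtains u where "u \<in> mset_atoms ZS" "size u = n"
proof -
  obtain m where n: "n = Suc m" using assms(1) by (cases n) auto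
  have "\<exists>u\<in>mset_atoms ZS. n \<le> size u"
  proof (rule ccontr)
    assume *: "\<not> ?thesis"
    have "davenport G \<le> enat m"
      unfolding davenport_eq
    proof (rule SUP_least)
      fix u assume "u \<in> mset_atoms ZS"
      then have "\<not> n \<le> size u" using * by blast
      then show "enat (size u) \<le> enat m" using n by simp
    qed
    with assms(2) have "enat n \<le> enat m" by (rule order_trans)
    then show False using n by simp
  qed
  then obtain u where "u \<in> mset_atoms ZS" "n \<le> size u" by blast
  with assms(1) atom_of_smaller_size that show thesis by metis
qed

end

context class_map
begin

text \<open>
  A multiset without zero-sum parts has finitely many parts, hence finitely many products of
  parts; a prime whose class is not inverse to any of them can be added.
\<close>

lemma zero_sum_free_of_size:
  assumes "infinite (carrier G)"
  shows "\<exists>T. set_mset T \<subseteq> P \<and> size T = n \<and> (\<forall>x\<in>ZS. x \<subseteq># T \<longrightarrow> x = {#})"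
proof (induction n)
  case 0
  then show ?case by (intro exI[of _ "{#}"]) simp
next
  case (Suc n)
  then obtain T where T: "set_mset T \<subseteq> P" "size T = n" "\<And>x. x \<in> ZS \<Longrightarrow> x \<subseteq># T \<Longrightarrow> x = {#}"
    by blast
  have "infinite (carrier G - (\<lambda>x. inv \<sigma> x) ` {x. x \<subseteq># T})"
    using assms finite_subset_msets[of T] by (intro Diff_infinite_finite) simp_all
  then obtain g where g: "g \<in> carrier G" "\<And>x. x \<subseteq># T \<Longrightarrow> g \<noteq> inv \<sigma> x"
    by (metis (no_types, lifting) DiffE finite.emptyI ex_in_conv image_eqI mem_Collect_eq)
  obtain p where p: "p \<in> P" "c p = g" using g(1) by (rule obtain_prime)
  have "x = {#}" if x: "x \<in> ZS" "x \<subseteq># add_mset p T" for x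
    using x(2)
  proof (cases rule: subset_add_mset_cases)
    case 1
    then show ?thesis using T(3) x(1) by blast
  next
    case (2 x')
    have x'P: "set_mset x' \<subseteq> P" using set_mset_mono[OF 2(2)] T(1) by blast
    then have "g \<otimes> \<sigma> x' = \<one>" using ZS_\<sigma>[OF x(1)] p 2(1) by (simp add: \<sigma>_add_mset)
    then have "g = inv \<sigma> x'" using g(1) x'P inv_equality[of g "\<sigma> x'"] by simp
    then show ?thesis using g(2) 2(2) by blast
  qed
  then show ?case using T p by (intro exI[of _ "add_mset p T"]) auto
qed

text \<open>
  A zero-sum-free multiset becomes an atom by adding a prime that makes its product trivial: of
  two zero-sum parts, one does not contain this prime.
\<close>

lemma large_atom_if_infinite:
  assumes "infinite (carrier G)"
  obtains u where "u \<in> mset_atoms ZS" "size u = Suc n"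
proof -
  obtain T where T: "set_mset T \<subseteq> P" "size T = n" "\<And>x. x \<in> ZS \<Longrightarrow> x \<subseteq># T \<Longrightarrow> x = {#}"
    using zero_sum_free_of_size[OF assms, of n] by blast
  obtain h where h: "h \<in> P" "c h = inv \<sigma> T" using obtain_prime[of "inv \<sigma> T"] T(1) by auto
  have uZ: "add_mset h T \<in> ZS" using h T(1) unfolding ZS_def by (simp add: \<sigma>_add_mset)
  have "add_mset h T \<in> mset_atoms ZS"
  proof (rule atomI[OF uZ])
    fix x y assume xy: "x \<in> ZS" "y \<in> ZS" "add_mset h T = x + y"
    have *: "b = {#}" if b: "a \<in> ZS" "b \<in> ZS" "add_mset h T = a + b" "h \<in># a" for a b
    proof -
      obtain a' where "a = add_mset h a'" using b(4) by (metis multi_member_split)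
      then have "T = a' + b" using b(3) by simp
      then show ?thesis using T(3) b(2) by simp
    qed
    have "h \<in># x + y" using xy(3) by (metis union_single_eq_member)
    then show "x = {#} \<or> y = {#}" using *[of x y] *[of y x] xy by (metis add.commute union_iff)
  qed simp
  then show thesis using that T(2) by simp
qed

lemma davenport_infinite:
  assumes "infinite (carrier G)"
  shows "davenport G = \<infinity>"
proof (rule ccontr)
  assume "davenport G \<noteq> \<infinity>"
  then obtain n where n: "davenport G = enat n" by auto
  obtain u where u: "u \<in> mset_atoms ZS" "size u = Suc n"
    using large_atom_if_infinite[OF assms, of n] by blast
  show False using size_atom_le_davenport[OF u(1)] u(2) n by simp
qed

end

section \<open>The groups of Davenport constant three\<close>

text \<open>
  By disjointness the copies of \<open>A\<close> on the right cannot come from those of \<open>C\<close> on the left, so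
  they are contained in \<open>z\<close>.
\<close>

lemma common_part_of_trade:
  assumes eq: "z + repeat_mset n C = z' + repeat_mset n A" and disj: "A \<inter># C = {#}"
  obtains w where "z = w + repeat_mset n A" "z' = w + repeat_mset n C"
proof -
  have count: "count z e + n * count C e = count z' e + n * count A e" for e
    using arg_cong[OF eq, of "\<lambda>m. count m e"] by simp
  have zero: "count A e = 0 \<or> count C e = 0" for e
    using arg_cong[OF disj, of "\<lambda>m. count m e"] by (auto simp: min_def split: if_splits)
  have le: "n * count A e \<le> count z e" for e
    using count[of e] zero[of e] by auto
  define w where "w = z - repeat_mset n A"
  have "z = w + repeat_mset n A"
    by (rule multiset_eqI) (simp add: w_def le)
  moreover have "z' = w + repeat_mset n C"
    using eq unfolding calculation by (metis add.commute add.left_commute add_left_imp_eq)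
  ultimately show thesis by (rule that)
qed

lemma fact_dist_trade:
  assumes "A \<inter># C = {#}"
  shows "fact_dist (w + repeat_mset n A) (w + repeat_mset n C) = n * max (size A) (size C)"
proof -
  have "repeat_mset n A \<inter># repeat_mset n C = {#}"
  proof (rule multiset_eqI)
    fix e
    have "min (count A e) (count C e) = 0"
      using arg_cong[OF assms, of "\<lambda>m. count m e"] by simp
    then show "count (repeat_mset n A \<inter># repeat_mset n C) e = count {#} e"
      by (auto simp: min_def split: if_splits)
  qed
  moreover have "size (repeat_mset n K) = n * size K" for K :: "'a multiset"
    by (induction n) simp_all
  ultimately show ?thesis
    by (simp add: fact_dist_add fact_dist_disjoint nat_mult_max_right)
qed

text \<open>
  If any two factorizations of an element differ by \<open>n\<close> trades of the three atoms \<open>A\<close> for the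
  two atoms \<open>C\<close>, their distance is \<open>3 * n\<close>. A single trade already introduces every atom that
  \<open>n\<close> trades introduce, so the nearest factorization containing a given new atom is at distance
  3.
\<close>

lemma Ta_of_single_trade:
  assumes A: "set_mset A \<subseteq> mset_atoms B" "size A = 3"
    and C: "set_mset C \<subseteq> mset_atoms B" "size C = 2"
    and AC: "A \<inter># C = {#}" "\<Sum>\<^sub># A = \<Sum>\<^sub># C"
    and trade: "\<And>a z z'. z \<in> mset_facts B a \<Longrightarrow> z' \<in> mset_facts B a \<Longrightarrow>
      \<exists>n. z + repeat_mset n C = z' + repeat_mset n A \<or> z' + repeat_mset n C = z + repeat_mset n A"
  shows "mset_Ta B \<subseteq> {3}"
proof
  have cases: "(\<exists>w n. z = w + repeat_mset n A \<and> z' = w + repeat_mset n C) \<or>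
      (\<exists>w n. z' = w + repeat_mset n A \<and> z = w + repeat_mset n C)"
    if "z \<in> mset_facts B a" "z' \<in> mset_facts B a" for a z z'
    using trade[OF that] common_part_of_trade[OF _ AC(1)] by metis
  have CA: "C \<inter># A = {#}" using AC(1) by (metis subset_mset.inf_commute)
  have ge3: "3 \<le> fact_dist z z'"
    if z: "z \<in> mset_facts B a" "z' \<in> mset_facts B a" "z \<noteq> z'" for a z z'
    using cases[OF z(1,2)]
  proof (elim disjE exE conjE)
    fix w n assume eqs: "z = w + repeat_mset n A" "z' = w + repeat_mset n C"
    then have "0 < n" using z(3) by (cases n) auto
    then show ?thesis unfolding eqs fact_dist_trade[OF AC(1)] A(2) C(2) by simp
  next
    fix w n assume eqs: "z' = w + repeat_mset n A" "z = w + repeat_mset n C"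
    then have "0 < n" using z(3) by (cases n) auto
    then show ?thesis unfolding eqs fact_dist_trade[OF CA] A(2) C(2) by simp
  qed
  \<comment> \<open>Both directions of the trade are needed, hence the generic names \<open>S\<close> and \<open>T\<close>: one of the \<open>n\<close>
    exchanges of \<open>S\<close> for \<open>T\<close> suffices to introduce \<open>u\<close>.\<close>
  have step: "\<exists>z''\<in>mset_facts B a. u \<in># z'' \<and> fact_dist z z'' \<le> 3"
    if z: "z \<in> mset_facts B a" "z' \<in> mset_facts B a" "u \<notin># z" "u \<in># z'"
      and eqs: "z = w + repeat_mset n S" "z' = w + repeat_mset n T"
      and ST: "S \<inter># T = {#}" "max (size S) (size T) = 3" "set_mset T \<subseteq> mset_atoms B"
        "\<Sum>\<^sub># S = \<Sum>\<^sub># T"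
    for a z z' u w n S T
  proof -
    have "u \<in># repeat_mset n T" using z(3,4) eqs by auto
    then have "0 < n * count T u" by (metis count_greater_zero_iff count_repeat_mset)
    then have uT: "u \<in># T" and "0 < n" by auto
    then obtain m where n: "n = Suc m" using gr0_implies_Suc by blast
    define r where "r = w + repeat_mset m S"
    have zr: "z = r + S" unfolding eqs(1) n r_def by simp
    have "r + T \<in> mset_facts B a"
      using z(1) ST(3,4) unfolding mset_facts_def zr by simp
    moreover have "fact_dist z (r + T) = 3"
      using fact_dist_trade[OF ST(1), of r 1] ST(2) unfolding zr by simp
    ultimately show ?thesis using uT by (intro bexI[of _ "r + T"]) simp_all
  qed
  fix t assume "t \<in> mset_Ta B"
  then obtain a u where t: "t = mset_tame B a u" and pos: "0 < mset_tame B a u"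
    unfolding mset_Ta_def by auto
  have "enat 1 \<le> mset_tame B a u" using pos by (simp add: Suc_ile_eq zero_enat_def)
  then obtain z z0 where z0: "z0 \<in> mset_facts B a" "u \<in># z0" and z: "z \<in> mset_facts B a"
    and far: "\<And>z'. z' \<in> mset_facts B a \<Longrightarrow> u \<in># z' \<Longrightarrow> 1 \<le> fact_dist z z'"
    using le_mset_tame_iff[of 1 B a u] by auto
  have "3 \<le> fact_dist z z'" if "z' \<in> mset_facts B a" "u \<in># z'" for z'
  proof (rule ge3[OF z that(1)])
    have "fact_dist z z = 0" by (simp add: fact_dist_eq)
    then show "z \<noteq> z'" using far[OF that] by auto
  qed
  then have "enat 3 \<le> mset_tame B a u" using le_mset_tame_iff[of 3 B a u] z z0 by auto
  moreover have "mset_tame B a u \<le> enat 3"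
    unfolding mset_tame_le_iff
  proof (intro ballI impI)
    fix y assume y: "y \<in> mset_facts B a"
    have "\<exists>z'\<in>mset_facts B a. u \<in># z' \<and> fact_dist y z' \<le> 3"
    proof (cases "u \<in># y")
      case True
      then show ?thesis using y by (intro bexI[of _ y]) (simp_all add: fact_dist_eq)
    next
      case False
      show ?thesis
        using cases[OF y z0(1)]
      proof (elim disjE exE conjE)
        fix w n assume "y = w + repeat_mset n A" "z0 = w + repeat_mset n C"
        from step[OF y z0(1) False z0(2) this AC(1) _ C(1) AC(2)] show ?thesis
          using A(2) C(2) by simp
      next
        fix w n assume "z0 = w + repeat_mset n A" "y = w + repeat_mset n C"
        from step[OF y z0(1) False z0(2) this(2,1) CA _ A(1) AC(2)[symmetric]] show ?thesis
          using A(2) C(2) by simp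
      qed
    qed
    then show "\<exists>z'\<in>mset_facts B a. u \<in># z' \<and> enat (fact_dist y z') \<le> enat 3" by simp
  qed
  ultimately show "t \<in> {3}" unfolding t by (simp add: numeral_eq_enat)
qed

lemma mset_eq_on:
  assumes "set_mset x \<subseteq> K" "set_mset y \<subseteq> K" "\<And>e. e \<in> K \<Longrightarrow> count x e = count y e"
  shows "x = y"
proof (rule multiset_eqI)
  fix e
  show "count x e = count y e"
    using assms by (cases "e \<in> K") (simp, metis not_in_iff subsetD)
qed

lemma mset_atom_countI:
  assumes u: "u \<in> B" "u \<noteq> {#}" "set_mset u \<subseteq> K"
    and "\<And>x. x \<in> B \<Longrightarrow> \<forall>e\<in>K. count x e \<le> count u e \<Longrightarrow>
      (\<forall>e\<in>K. count x e = 0) \<or> (\<forall>e\<in>K. count x e = count u e)"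
  shows "u \<in> mset_atoms B"
proof -
  have "x = {#} \<or> x = u" if x: "x \<in> B" "x \<subseteq># u" for x
  proof -
    have "set_mset x \<subseteq> K" using set_mset_mono[OF x(2)] u(3) by simp
    moreover have "\<forall>e\<in>K. count x e \<le> count u e" using x(2) by (simp add: mset_subset_eq_count)
    ultimately show ?thesis
      using assms(4)[OF x(1)] u(3) mset_eq_on[of x K u] mset_eq_on[of x K "{#}"] by auto
  qed
  then show ?thesis using u(1,2) unfolding mset_atoms_def by auto
qed

lemma mset_atom_eq_countI:
  assumes "u \<in> mset_atoms B" "x \<in> B" "x \<noteq> {#}" "set_mset x \<subseteq> K"
    and "\<forall>e\<in>K. count x e \<le> count u e"
  shows "x = u"
proof (rule mset_atom_eqI[OF assms(1-3)])
  show "x \<subseteq># u"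
  proof (rule mset_subset_eqI)
    fix e show "count x e \<le> count u e"
      using assms(4,5) by (cases "e \<in># x") (auto simp: not_in_iff)
  qed
qed

lemma zero_sum_C3:
  "S \<in> carrier (zero_sum_monoid (integer_mod_group 3)) \<longleftrightarrow>
    set_mset S \<subseteq> {0, 1, 2} \<and> 3 dvd (count S 1 + 2 * count S 2)"
proof -
  interpret comm_group "integer_mod_group 3" by simp
  have carrier: "carrier (integer_mod_group 3) = {0, 1, 2}"
    by (auto simp: carrier_integer_mod_group)
  have "mset_prod (integer_mod_group 3) S = int (count S 1 + 2 * count S 2) mod 3"
    if "set_mset S \<subseteq> {0, 1, 2}" for S
    using that
  proof (induction S)
    case (add g S)
    then have "mset_prod (integer_mod_group 3) (add_mset g S)
        = (g + int (count S 1 + 2 * count S 2) mod 3) mod 3"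
      using mset_prod_add_mset[of g S] unfolding carrier by simp
    also have "\<dots> = (g + int (count S 1 + 2 * count S 2)) mod 3" by (rule mod_add_right_eq)
    also have "\<dots> = int (count (add_mset g S) 1 + 2 * count (add_mset g S) 2) mod 3"
    proof -
      have "g = 0 \<or> g = 1 \<or> g = 2" using add.prems by auto
      then show ?thesis by (elim disjE) (simp_all add: algebra_simps)
    qed
    finally show ?case .
  qed simp
  moreover have "int n mod 3 = 0 \<longleftrightarrow> 3 dvd n" for n by presburger
  ultimately have "mset_prod (integer_mod_group 3) S = 0 \<longleftrightarrow> 3 dvd (count S 1 + 2 * count S 2)"
    if "set_mset S \<subseteq> {0, 1, 2}" for S
    using that by (simp only:)
  then show ?thesis
    unfolding carrier_zero_sum_monoid carrier one_integer_mod_group by blast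
qed

text \<open>
  Apart from the prime \<open>0\<close>, the atoms are \<open>111\<close>, \<open>222\<close> and \<open>12\<close>. The numbers of the first two
  are determined by the number of the third and the multiplicities of \<open>1\<close> and \<open>2\<close>, so the only
  trade is three times \<open>12\<close> for \<open>111\<close> and \<open>222\<close>.
\<close>

lemma Ta_C3: "Ta (zero_sum_monoid (integer_mod_group 3)) = {3}"
proof -
  interpret comm_group "integer_mod_group 3" by simp
  interpret id: class_map "integer_mod_group 3" "carrier (integer_mod_group 3)" "\<lambda>g. g"
    by (rule class_map_id)
  define B where "B = carrier (zero_sum_monoid (integer_mod_group 3))"
  have B: "S \<in> B \<longleftrightarrow> set_mset S \<subseteq> {0, 1, 2} \<and> 3 dvd (count S 1 + 2 * count S 2)" for S
    unfolding B_def by (rule zero_sum_C3)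
  define O' where "O' = {#0::int#}"
  define A where "A = {#1::int, 1, 1#}"
  define A' where "A' = {#2::int, 2, 2#}"
  define W where "W = {#1::int, 2#}"
  note defs = O'_def A_def A'_def W_def
  have in_B: "O' \<in> B" "A \<in> B" "A' \<in> B" "W \<in> B"
    by (simp_all add: B defs) presburger+
  have A: "A \<in> mset_atoms B"
  proof (rule mset_atom_countI[where K = "{0, 1, 2}"])
    fix x assume "x \<in> B" "\<forall>e\<in>{0, 1, 2}. count x e \<le> count A e"
    then have "3 dvd (count x 1 + 2 * count x 2)" "count x 0 = 0" "count x 1 \<le> 3" "count x 2 = 0"
      using B[of x] by (auto simp: A_def)
    then show "(\<forall>e\<in>{0, 1, 2}. count x e = 0) \<or> (\<forall>e\<in>{0, 1, 2}. count x e = count A e)"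
      unfolding A_def by simp presburger
  qed (use in_B in \<open>auto simp: A_def\<close>)
  have A': "A' \<in> mset_atoms B"
  proof (rule mset_atom_countI[where K = "{0, 1, 2}"])
    fix x assume "x \<in> B" "\<forall>e\<in>{0, 1, 2}. count x e \<le> count A' e"
    then have "3 dvd (count x 1 + 2 * count x 2)" "count x 0 = 0" "count x 1 = 0" "count x 2 \<le> 3"
      using B[of x] by (auto simp: A'_def)
    then show "(\<forall>e\<in>{0, 1, 2}. count x e = 0) \<or> (\<forall>e\<in>{0, 1, 2}. count x e = count A' e)"
      unfolding A'_def by simp presburger
  qed (use in_B in \<open>auto simp: A'_def\<close>)
  have W: "W \<in> mset_atoms B"
  proof (rule mset_atom_countI[where K = "{0, 1, 2}"])
    fix x assume "x \<in> B" "\<forall>e\<in>{0, 1, 2}. count x e \<le> count W e"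
    then have "3 dvd (count x 1 + 2 * count x 2)" "count x 0 = 0" "count x 1 \<le> 1" "count x 2 \<le> 1"
      using B[of x] by (auto simp: W_def)
    then show "(\<forall>e\<in>{0, 1, 2}. count x e = 0) \<or> (\<forall>e\<in>{0, 1, 2}. count x e = count W e)"
      unfolding W_def by simp presburger
  qed (use in_B in \<open>auto simp: W_def\<close>)
  have atoms: "mset_atoms B \<subseteq> {O', A, A', W}"
  proof
    fix u assume u: "u \<in> mset_atoms B"
    have uB: "set_mset u \<subseteq> {0, 1, 2}" "3 dvd (count u 1 + 2 * count u 2)" "u \<noteq> {#}"
      using mset_atomsD(1,2)[OF u] B by auto
    note eqI = mset_atom_eq_countI[OF u, where K = "{0, 1, 2}"]
    have "\<not> (count u 0 = 0 \<and> count u 1 = 0 \<and> count u 2 = 0)"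
      using mset_eq_on[of u "{0, 1, 2}" "{#}"] uB by auto
    then consider "1 \<le> count u 0" | "1 \<le> count u 1" "1 \<le> count u 2"
      | "3 \<le> count u 1" | "3 \<le> count u 2"
      using uB(2) by atomize_elim presburger
    then show "u \<in> {O', A, A', W}"
    proof cases
      case 1
      then have "O' = u" by (intro eqI in_B) (simp_all add: O'_def)
      then show ?thesis by simp
    next
      case 2
      then have "W = u" by (intro eqI in_B) (simp_all add: W_def)
      then show ?thesis by simp
    next
      case 3
      then have "A = u" by (intro eqI in_B) (simp_all add: A_def)
      then show ?thesis by simp
    next
      case 4
      then have "A' = u" by (intro eqI in_B) (simp_all add: A'_def)
      then show ?thesis by simp
    qed
  qed
  have dist: "O' \<noteq> A" "O' \<noteq> A'" "O' \<noteq> W" "A \<noteq> A'" "A \<noteq> W" "A' \<noteq> W"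
    unfolding defs by (auto dest: arg_cong[of _ _ "\<lambda>m. count m 1"] arg_cong[of _ _ size])
  have counts: "count (\<Sum>\<^sub># z) 0 = count z O' \<and> count (\<Sum>\<^sub># z) 1 = 3 * count z A + count z W \<and>
    count (\<Sum>\<^sub># z) 2 = 3 * count z A' + count z W" if "set_mset z \<subseteq> {O', A, A', W}" for z
    using that
  proof (induction z)
    case (add v z)
    then consider "v = O'" | "v = A" | "v = A'" | "v = W" by auto
    then show ?case using add dist dist[symmetric] by cases (simp_all add: defs)
  qed simp
  have "mset_Ta B \<subseteq> {3}"
  proof (rule Ta_of_single_trade[of "{#W, W, W#}" B "{#A, A'#}"])
    show "{#W, W, W#} \<inter># {#A, A'#} = {#}" using dist by simp
    show "\<Sum>\<^sub># {#W, W, W#} = \<Sum>\<^sub># {#A, A'#}"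
      by (rule mset_eq_on[of _ "{1, 2}"]) (auto simp: defs)
    fix a z z' assume z: "z \<in> mset_facts B a" and z': "z' \<in> mset_facts B a"
    have sets: "set_mset z \<subseteq> {O', A, A', W}" "set_mset z' \<subseteq> {O', A, A', W}"
      using z z' atoms unfolding mset_facts_def by auto
    have sum: "\<Sum>\<^sub># z = \<Sum>\<^sub># z'" using z z' unfolding mset_facts_def by simp
    note c = counts[OF sets(1)] counts[OF sets(2), folded sum]
    have *: "x + repeat_mset n {#A, A'#} = y + repeat_mset n {#W, W, W#}"
      if "set_mset x \<subseteq> {O', A, A', W}" "set_mset y \<subseteq> {O', A, A', W}" "count x O' = count y O'"
        "count x W = count y W + 3 * n" "count y A = count x A + n" "count y A' = count x A' + n"
      for x y n
      by (rule mset_eq_on[of _ "{O', A, A', W}"]) (use that dist dist[symmetric] in auto)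
    show "\<exists>n. z + repeat_mset n {#A, A'#} = z' + repeat_mset n {#W, W, W#} \<or>
        z' + repeat_mset n {#A, A'#} = z + repeat_mset n {#W, W, W#}"
    proof (cases "count z' W \<le> count z W")
      case True
      define n where "n = count z' A - count z A"
      have "z + repeat_mset n {#A, A'#} = z' + repeat_mset n {#W, W, W#}"
        by (rule *) (use sets c True n_def in auto)
      then show ?thesis by blast
    next
      case False
      define n where "n = count z A - count z' A"
      have "z' + repeat_mset n {#A, A'#} = z + repeat_mset n {#W, W, W#}"
        by (rule *) (use sets c False n_def in auto)
      then show ?thesis by blast
    qed
  qed (use A A' W in simp_all)
  moreover have "enat 3 \<in> mset_Ta B"
    using id.size_atom_in_Ta[of A 3] A unfolding ZS_id B_def[symmetric] by (simp add: A_def)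
  ultimately show ?thesis
    unfolding Ta_zero_sum_monoid B_def[symmetric] by (auto simp: numeral_eq_enat)
qed

lemma comm_group_C2_C2: "comm_group (integer_mod_group 2 \<times>\<times> integer_mod_group 2)"
  by (rule group.group_comm_groupI[OF DirProd_group]) (auto simp: add.commute)

lemma zero_sum_C2_C2:
  "S \<in> carrier (zero_sum_monoid (integer_mod_group 2 \<times>\<times> integer_mod_group 2)) \<longleftrightarrow>
    set_mset S \<subseteq> {(0, 0), (0, 1), (1, 0), (1, 1)} \<and>
    even (count S (1, 0) + count S (1, 1)) \<and> even (count S (0, 1) + count S (1, 1))"
proof -
  let ?G = "integer_mod_group 2 \<times>\<times> integer_mod_group 2"
  let ?K = "{(0, 0), (0, 1), (1, 0), (1, 1)} :: (int \<times> int) set"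
  interpret comm_group ?G by (rule comm_group_C2_C2)
  have carrier: "carrier ?G = ?K"
    by (auto simp: carrier_integer_mod_group)
  have "mset_prod ?G S = (int (count S (1, 0) + count S (1, 1)) mod 2,
      int (count S (0, 1) + count S (1, 1)) mod 2)"
    if "set_mset S \<subseteq> ?K" for S
    using that
  proof (induction S)
    case (add g S)
    then have "mset_prod ?G (add_mset g S) = g \<otimes>\<^bsub>?G\<^esub> (int (count S (1, 0) + count S (1, 1)) mod 2,
      int (count S (0, 1) + count S (1, 1)) mod 2)"
      using mset_prod_add_mset[of g S] unfolding carrier by simp
    also have "\<dots> = ((fst g + int (count S (1, 0) + count S (1, 1))) mod 2,
        (snd g + int (count S (0, 1) + count S (1, 1))) mod 2)"
      by (simp add: mult_DirProd' mod_add_right_eq)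
    also have "\<dots> = (int (count (add_mset g S) (1, 0) + count (add_mset g S) (1, 1)) mod 2,
      int (count (add_mset g S) (0, 1) + count (add_mset g S) (1, 1)) mod 2)"
    proof -
      have "g = (0, 0) \<or> g = (0, 1) \<or> g = (1, 0) \<or> g = (1, 1)" using add.prems by auto
      then show ?thesis by (elim disjE) (simp_all add: algebra_simps)
    qed
    finally show ?case .
  qed simp
  moreover have "int n mod 2 = 0 \<longleftrightarrow> even n" for n by presburger
  ultimately have "mset_prod ?G S = \<one>\<^bsub>?G\<^esub> \<longleftrightarrow>
      even (count S (1, 0) + count S (1, 1)) \<and> even (count S (0, 1) + count S (1, 1))"
    if "set_mset S \<subseteq> ?K" for S
    using that by (simp only: one_DirProd one_integer_mod_group prod.inject)
  then show ?thesis
    unfolding carrier_zero_sum_monoid carrier by blast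
qed

text \<open>
  Apart from the prime \<open>(0, 0)\<close>, the atoms are the squares \<open>A1\<close>, \<open>A2\<close>, \<open>A3\<close> of the three
  involutions and the product \<open>W\<close> of all three. The only trade is \<open>A1\<close>, \<open>A2\<close>, \<open>A3\<close> for two
  copies of \<open>W\<close>.
\<close>

lemma Ta_C2_C2: "Ta (zero_sum_monoid (integer_mod_group 2 \<times>\<times> integer_mod_group 2)) = {3}"
proof -
  let ?G = "integer_mod_group 2 \<times>\<times> integer_mod_group 2"
  let ?K = "{(0, 0), (0, 1), (1, 0), (1, 1)} :: (int \<times> int) set"
  interpret comm_group ?G by (rule comm_group_C2_C2)
  interpret id: class_map ?G "carrier ?G" "\<lambda>g. g"
    by (rule class_map_id)
  define B where "B = carrier (zero_sum_monoid ?G)"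
  have B: "S \<in> B \<longleftrightarrow> set_mset S \<subseteq> ?K \<and>
      even (count S (1, 0) + count S (1, 1)) \<and> even (count S (0, 1) + count S (1, 1))" for S
    unfolding B_def by (rule zero_sum_C2_C2)
  define O' where "O' = {#(0, 0) :: int \<times> int#}"
  define A1 where "A1 = {#(0, 1) :: int \<times> int, (0, 1)#}"
  define A2 where "A2 = {#(1, 0) :: int \<times> int, (1, 0)#}"
  define A3 where "A3 = {#(1, 1) :: int \<times> int, (1, 1)#}"
  define W where "W = {#(0, 1) :: int \<times> int, (1, 0), (1, 1)#}"
  note defs = O'_def A1_def A2_def A3_def W_def
  have in_B: "O' \<in> B" "A1 \<in> B" "A2 \<in> B" "A3 \<in> B" "W \<in> B"
    by (simp_all add: B defs)
  have A: "u \<in> mset_atoms B" if u: "u \<in> {A1, A2, A3, W}" for u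
  proof (rule mset_atom_countI[where K = ?K])
    show "u \<in> B" "u \<noteq> {#}" "set_mset u \<subseteq> ?K" using u in_B by (auto simp: defs)
    fix x assume x: "x \<in> B" "\<forall>e\<in>?K. count x e \<le> count u e"
    then have ev: "even (count x (1, 0) + count x (1, 1))" "even (count x (0, 1) + count x (1, 1))"
      using B[of x] by auto
    consider "u = A1" | "u = A2" | "u = A3" | "u = W" using u by auto
    then show "(\<forall>e\<in>?K. count x e = 0) \<or> (\<forall>e\<in>?K. count x e = count u e)"
    proof cases
      case 1
      then show ?thesis using x(2) ev unfolding A1_def by simp presburger
    next
      case 2
      then show ?thesis using x(2) ev unfolding A2_def by simp presburger
    next
      case 3
      then show ?thesis using x(2) ev unfolding A3_def by simp presburger
    next
      case 4
      then show ?thesis using x(2) ev unfolding W_def by simp presburger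
    qed
  qed
  have atoms: "mset_atoms B \<subseteq> {O', A1, A2, A3, W}"
  proof
    fix u assume u: "u \<in> mset_atoms B"
    have uB: "set_mset u \<subseteq> ?K" "even (count u (1, 0) + count u (1, 1))"
      "even (count u (0, 1) + count u (1, 1))" "u \<noteq> {#}"
      using mset_atomsD(1,2)[OF u] B by auto
    note eqI = mset_atom_eq_countI[OF u, where K = ?K]
    have "\<not> (count u (0, 0) = 0 \<and> count u (0, 1) = 0 \<and> count u (1, 0) = 0 \<and> count u (1, 1) = 0)"
      using mset_eq_on[of u ?K "{#}"] uB by auto
    then consider "1 \<le> count u (0, 0)" | "2 \<le> count u (0, 1)" | "2 \<le> count u (1, 0)"
      | "2 \<le> count u (1, 1)" | "1 \<le> count u (0, 1)" "1 \<le> count u (1, 0)" "1 \<le> count u (1, 1)"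
      using uB(2,3) by atomize_elim presburger
    then show "u \<in> {O', A1, A2, A3, W}"
    proof cases
      case 1
      then have "O' = u" by (intro eqI in_B) (simp_all add: O'_def)
      then show ?thesis by simp
    next
      case 2
      then have "A1 = u" by (intro eqI in_B) (simp_all add: A1_def)
      then show ?thesis by simp
    next
      case 3
      then have "A2 = u" by (intro eqI in_B) (simp_all add: A2_def)
      then show ?thesis by simp
    next
      case 4
      then have "A3 = u" by (intro eqI in_B) (simp_all add: A3_def)
      then show ?thesis by simp
    next
      case 5
      then have "W = u" by (intro eqI in_B) (simp_all add: W_def)
      then show ?thesis by simp
    qed
  qed
  have dist: "O' \<noteq> A1" "O' \<noteq> A2" "O' \<noteq> A3" "O' \<noteq> W" "A1 \<noteq> A2" "A1 \<noteq> A3" "A1 \<noteq> W"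
      "A2 \<noteq> A3" "A2 \<noteq> W" "A3 \<noteq> W"
    unfolding defs
    by (auto dest: arg_cong[of _ _ "\<lambda>m. count m (0, 1)"] arg_cong[of _ _ "\<lambda>m. count m (1, 0)"]
        arg_cong[of _ _ size])
  have counts: "count (\<Sum>\<^sub># z) (0, 0) = count z O' \<and>
      count (\<Sum>\<^sub># z) (0, 1) = 2 * count z A1 + count z W \<and>
      count (\<Sum>\<^sub># z) (1, 0) = 2 * count z A2 + count z W \<and>
      count (\<Sum>\<^sub># z) (1, 1) = 2 * count z A3 + count z W"
    if "set_mset z \<subseteq> {O', A1, A2, A3, W}" for z
    using that
  proof (induction z)
    case (add v z)
    then consider "v = O'" | "v = A1" | "v = A2" | "v = A3" | "v = W" by auto
    then show ?case using add dist dist[symmetric] by cases (simp_all add: defs)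
  qed simp
  have "mset_Ta B \<subseteq> {3}"
  proof (rule Ta_of_single_trade[of "{#A1, A2, A3#}" B "{#W, W#}"])
    show "{#A1, A2, A3#} \<inter># {#W, W#} = {#}" using dist dist[symmetric] by simp
    show "\<Sum>\<^sub># {#A1, A2, A3#} = \<Sum>\<^sub># {#W, W#}"
      by (rule mset_eq_on[of _ ?K]) (auto simp: defs)
    fix a z z' assume z: "z \<in> mset_facts B a" and z': "z' \<in> mset_facts B a"
    have sets: "set_mset z \<subseteq> {O', A1, A2, A3, W}" "set_mset z' \<subseteq> {O', A1, A2, A3, W}"
      using z z' atoms unfolding mset_facts_def by auto
    have sum: "\<Sum>\<^sub># z = \<Sum>\<^sub># z'" using z z' unfolding mset_facts_def by simp
    note c = counts[OF sets(1)] counts[OF sets(2), folded sum]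
    have *: "x + repeat_mset n {#W, W#} = y + repeat_mset n {#A1, A2, A3#}"
      if "set_mset x \<subseteq> {O', A1, A2, A3, W}" "set_mset y \<subseteq> {O', A1, A2, A3, W}"
        "count x O' = count y O'" "count y W = count x W + 2 * n" "count x A1 = count y A1 + n"
        "count x A2 = count y A2 + n" "count x A3 = count y A3 + n"
      for x y n
      by (rule mset_eq_on[of _ "{O', A1, A2, A3, W}"]) (use that dist dist[symmetric] in auto)
    show "\<exists>n. z + repeat_mset n {#W, W#} = z' + repeat_mset n {#A1, A2, A3#} \<or>
        z' + repeat_mset n {#W, W#} = z + repeat_mset n {#A1, A2, A3#}"
    proof (cases "count z' A1 \<le> count z A1")
      case True
      define n where "n = count z A1 - count z' A1"
      have "z + repeat_mset n {#W, W#} = z' + repeat_mset n {#A1, A2, A3#}"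
        by (rule *) (use sets c True n_def in auto)
      then show ?thesis by blast
    next
      case False
      define n where "n = count z' A1 - count z A1"
      have "z' + repeat_mset n {#W, W#} = z + repeat_mset n {#A1, A2, A3#}"
        by (rule *) (use sets c False n_def in auto)
      then show ?thesis by blast
    qed
  qed (use A in simp_all)
  moreover have "enat 3 \<in> mset_Ta B"
    using id.size_atom_in_Ta[of W 3] A unfolding ZS_id B_def[symmetric] by (simp add: W_def)
  ultimately show ?thesis
    unfolding Ta_zero_sum_monoid B_def[symmetric] by (auto simp: numeral_eq_enat)
qed

section \<open>Krull monoids and their class groups\<close>

lemma frag_of_mset_empty [simp]: "frag_of_mset {#} = 0"
  by (simp add: frag_of_mset_def)

lemma frag_of_mset_union [simp]: "frag_of_mset (S + T) = frag_of_mset S + frag_of_mset T"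
  by (simp add: frag_of_mset_def)

lemma frag_of_mset_add_mset [simp]: "frag_of_mset (add_mset p S) = frag_of p + frag_of_mset S"
  by (simp add: frag_of_mset_def)

lemma lookup_frag_of_mset: "Poly_Mapping.lookup (frag_of_mset S) p = int (count S p)"
  by (induction S) (simp_all add: lookup_add)

lemma frag_of_mset_inject: "frag_of_mset S = frag_of_mset T \<longleftrightarrow> S = T"
  by (metis lookup_frag_of_mset multiset_eqI of_nat_eq_iff)

lemma keys_frag_of_mset: "Poly_Mapping.keys (frag_of_mset S) = set_mset S"
  by (auto simp: in_keys_iff lookup_frag_of_mset)

locale krull = fixes H :: "('a, 'm) monoid_scheme" (structure)
  and P :: "'p set" and \<phi> :: "'a \<Rightarrow> 'p multiset"
  assumes krull: "krull_monoid_with H P \<phi>"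
begin

sublocale comm_monoid_cancel H
  using krull by (simp add: krull_monoid_with_def)

lemma \<phi>_hom: "\<phi> \<in> hom H (free_comm_monoid P)"
  using krull by (simp add: krull_monoid_with_def divisor_theory_def)

lemma \<phi>_subset: "a \<in> carrier H \<Longrightarrow> set_mset (\<phi> a) \<subseteq> P"
  using \<phi>_hom by (auto simp: hom_def free_comm_monoid_def)

sublocale divisor_hom H \<phi>
proof
  fix a b assume ab: "a \<in> carrier H" "b \<in> carrier H"
  show "\<phi> (a \<otimes> b) = \<phi> a + \<phi> b"
    using \<phi>_hom ab by (simp add: hom_def free_comm_monoid_def)
  assume "\<phi> a \<subseteq># \<phi> b"
  then have "\<phi> b = \<phi> a + (\<phi> b - \<phi> a)" by simp
  moreover have "set_mset (\<phi> b - \<phi> a) \<subseteq> P"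
    using \<phi>_subset[OF ab(2)] by (auto dest: in_diffD)
  ultimately have "\<phi> a divides\<^bsub>free_comm_monoid P\<^esub> \<phi> b"
    by (intro dividesI[of "\<phi> b - \<phi> a"]) (simp_all add: free_comm_monoid_def)
  then show "a divides b"
    using krull ab by (simp add: krull_monoid_with_def divisor_theory_def)
qed

abbreviation N :: "('p \<Rightarrow>\<^sub>0 int) set" where "N \<equiv> principal_divisors H \<phi>"

lemma subgroup_principal: "subgroup N (free_Abelian_group P)"
proof (rule group.subgroupI)
  show "N \<subseteq> carrier (free_Abelian_group P)"
  proof
    fix x assume "x \<in> N"
    then obtain a b where "x = frag_of_mset (\<phi> a) - frag_of_mset (\<phi> b)" "a \<in> carrier H" "b \<in> carrier H"
      unfolding principal_divisors_def by blast
    then show "x \<in> carrier (free_Abelian_group P)"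
      using keys_diff[of "frag_of_mset (\<phi> a)" "frag_of_mset (\<phi> b)"] \<phi>_subset
      unfolding keys_frag_of_mset by simp blast
  qed
  then have inv: "inv\<^bsub>free_Abelian_group P\<^esub> x = - x" if "x \<in> N" for x
    using that by (simp add: subset_iff)
  show "N \<noteq> {}" unfolding principal_divisors_def by auto
  fix x y assume x: "x \<in> N" and y: "y \<in> N"
  obtain a b where ab: "x = frag_of_mset (\<phi> a) - frag_of_mset (\<phi> b)" "a \<in> carrier H" "b \<in> carrier H"
    using x unfolding principal_divisors_def by blast
  have "- x = frag_of_mset (\<phi> b) - frag_of_mset (\<phi> a)" using ab by simp
  then show "inv\<^bsub>free_Abelian_group P\<^esub> x \<in> N"
    unfolding inv[OF x] using ab unfolding principal_divisors_def by blast
  obtain a' b' where a'b': "y = frag_of_mset (\<phi> a') - frag_of_mset (\<phi> b')" "a' \<in> carrier H" "b' \<in> carrier H"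
    using y unfolding principal_divisors_def by blast
  have "x + y = frag_of_mset (\<phi> (a \<otimes> a')) - frag_of_mset (\<phi> (b \<otimes> b'))"
    using ab a'b' by (simp add: hom_mult)
  then show "x \<otimes>\<^bsub>free_Abelian_group P\<^esub> y \<in> N"
    using ab a'b' unfolding principal_divisors_def by auto
qed simp

sublocale N: normal N "free_Abelian_group P"
  by (rule comm_group.subgroup_imp_normal[OF abelian_free_Abelian_group subgroup_principal])

abbreviation \<G> :: "('p \<Rightarrow>\<^sub>0 int) set monoid" where "\<G> \<equiv> class_group H P \<phi>"

lemma comm_group_class_group: "comm_group \<G>"
  unfolding class_group_def
  by (rule comm_group.abelian_FactGroup[OF abelian_free_Abelian_group subgroup_principal])

lemma divisor_class_closed: "p \<in> P \<Longrightarrow> divisor_class H P \<phi> p \<in> carrier \<G>"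
  by (auto simp: divisor_class_def class_group_def FactGroup_def RCOSETS_def)

lemma product_of_classes:
  assumes "set_mset S \<subseteq> P"
  shows "mset_prod \<G> (image_mset (divisor_class H P \<phi>) S) = N #>\<^bsub>free_Abelian_group P\<^esub> frag_of_mset S"
proof -
  interpret \<G>: comm_group \<G> by (rule comm_group_class_group)
  show ?thesis using assms
  proof (induction S)
    case empty
    have "N #>\<^bsub>free_Abelian_group P\<^esub> 0 = N" by (metis N.coset_mult_one N.subset one_free_Abelian_group)
    moreover have "\<one>\<^bsub>\<G>\<^esub> = N" by (simp add: class_group_def FactGroup_def)
    ultimately show ?case by simp
  next
    case (add p S)
    then have pS: "p \<in> P" "set_mset S \<subseteq> P" by auto
    have classes: "set_mset (image_mset (divisor_class H P \<phi>) S) \<subseteq> carrier \<G>"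
      using pS(2) divisor_class_closed by auto
    have "mset_prod \<G> (image_mset (divisor_class H P \<phi>) (add_mset p S)) =
        divisor_class H P \<phi> p \<otimes>\<^bsub>\<G>\<^esub> (N #>\<^bsub>free_Abelian_group P\<^esub> frag_of_mset S)"
      using \<G>.mset_prod_add_mset[OF divisor_class_closed[OF pS(1)] classes] add.IH[OF pS(2)] by simp
    also have "\<dots> = N #>\<^bsub>free_Abelian_group P\<^esub> (frag_of p + frag_of_mset S)"
      using N.rcos_sum[of "frag_of p" "frag_of_mset S"] pS
      by (simp add: class_group_def FactGroup_def divisor_class_def keys_frag_of_mset)
    finally show ?case by simp
  qed
qed

text \<open>
  An effective divisor that is a difference of principal ones, \<open>\<phi> a = \<phi> b + S\<close>, is principal
  because \<open>\<phi>\<close> reflects the divisibility of \<open>\<phi> a\<close> by \<open>\<phi> b\<close>.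
\<close>

lemma frag_of_mset_principal_iff:
  assumes "set_mset S \<subseteq> P"
  shows "frag_of_mset S \<in> N \<longleftrightarrow> S \<in> \<phi> ` carrier H"
proof
  assume "frag_of_mset S \<in> N"
  then obtain a b where ab: "a \<in> carrier H" "b \<in> carrier H"
    "frag_of_mset S = frag_of_mset (\<phi> a) - frag_of_mset (\<phi> b)"
    unfolding principal_divisors_def by blast
  then have "frag_of_mset (\<phi> b + S) = frag_of_mset (\<phi> a)" by simp
  then have a: "\<phi> a = \<phi> b + S" by (simp only: frag_of_mset_inject)
  then obtain d where "d \<in> carrier H" "a = b \<otimes> d"
    using divides_reflect[of b a] ab by (auto simp: factor_def)
  then have "S = \<phi> d" using a ab hom_mult by simp
  then show "S \<in> \<phi> ` carrier H" using \<open>d \<in> carrier H\<close> by blast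
next
  assume "S \<in> \<phi> ` carrier H"
  then obtain a where a: "a \<in> carrier H" "S = \<phi> a" by blast
  have "frag_of_mset S = frag_of_mset (\<phi> a) - frag_of_mset (\<phi> \<one>)"
    using a by (simp add: hom_one)
  then show "frag_of_mset S \<in> N" unfolding principal_divisors_def using a by blast
qed

lemma class_map_divisor_class:
  assumes "\<forall>C\<in>carrier \<G>. primes_in_class H P \<phi> C \<noteq> {}"
  shows "class_map \<G> P (divisor_class H P \<phi>)"
proof -
  have "divisor_class H P \<phi> ` P = carrier \<G>"
  proof (intro subset_antisym subsetI)
    fix C assume "C \<in> carrier \<G>"
    then obtain p where "p \<in> primes_in_class H P \<phi> C" using assms by fast
    then show "C \<in> divisor_class H P \<phi> ` P" unfolding primes_in_class_def by auto
  qed (auto simp: divisor_class_closed)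
  then show ?thesis
    using comm_group_class_group by (simp add: class_map_def class_map_axioms_def)
qed

lemma ZS_eq_image:
  assumes "class_map \<G> P (divisor_class H P \<phi>)"
  shows "class_map.ZS \<G> P (divisor_class H P \<phi>) = \<phi> ` carrier H"
proof -
  have "S \<in> class_map.ZS \<G> P (divisor_class H P \<phi>) \<longleftrightarrow> S \<in> \<phi> ` carrier H" for S
  proof (cases "set_mset S \<subseteq> P")
    case True
    have "S \<in> class_map.ZS \<G> P (divisor_class H P \<phi>) \<longleftrightarrow> N #>\<^bsub>free_Abelian_group P\<^esub> frag_of_mset S = N"
      unfolding class_map.ZS_def[OF assms] class_map.\<sigma>_def[OF assms]
      using True product_of_classes[OF True] by (simp add: class_group_def FactGroup_def)
    also have "\<dots> \<longleftrightarrow> frag_of_mset S \<in> N"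
      using N.coset_join1[of N "frag_of_mset S"] N.coset_join2[of "frag_of_mset S" N]
        subgroup_principal True by (auto simp: keys_frag_of_mset)
    finally show ?thesis using frag_of_mset_principal_iff[OF True] by simp
  next
    case False
    then show ?thesis
      unfolding class_map.ZS_def[OF assms] using \<phi>_subset by auto
  qed
  then show ?thesis by blast
qed

end

theorem theorem5p2:
  fixes H :: "('a, 'm) monoid_scheme"
    and P :: "'p set"
    and \<phi> :: "'a \<Rightarrow> 'p multiset"
    and G :: "('p \<Rightarrow>\<^sub>0 int) set monoid"
  assumes krull: "krull_monoid_with H P \<phi>"
    and class_group: "G = class_group H P \<phi>"
    and davenport: "davenport G \<ge> 3"
    and primes: "\<forall>C\<in>carrier G. primes_in_class H P \<phi> C \<noteq> {}"
  shows "(Ta (zero_sum_monoid (integer_mod_group 3)) = {3} \<and>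
      Ta (zero_sum_monoid (integer_mod_group 2 \<times>\<times> integer_mod_group 2)) = {3} \<and>
      (finite (carrier G) \<and>
       (davenport G \<ge> 4 \<or>
        (\<exists>C\<in>carrier G. C \<noteq> \<one>\<^bsub>G\<^esub> \<and>
           (\<exists>p\<in>primes_in_class H P \<phi> C. \<exists>q\<in>primes_in_class H P \<phi> C. p \<noteq> q)))
       \<longrightarrow> int_interval 2 (davenport G) \<subseteq> Ta H)) \<and>
    ((\<forall>C\<in>carrier G. infinite (primes_in_class H P \<phi> C) \<or>
         davenport G + 1 \<le> enat (card (primes_in_class H P \<phi> C)))
      \<longrightarrow> Ta H = int_interval 2 (tame_degree H)) \<and>
    (infinite (carrier G) \<longrightarrow> Ta H = enat ` {2..})"
proof -
  interpret krull H P \<phi> by unfold_locales (rule krull)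
  interpret class_map G P "divisor_class H P \<phi>"
    using class_map_divisor_class primes class_group by simp
  have Ta: "Ta H = mset_Ta ZS"
    using Ta_eq ZS_eq_image class_map_axioms class_group by simp
  have primes_in: "primes_in_class H P \<phi> C = {p \<in> P. divisor_class H P \<phi> p = C}" for C
    by (simp add: primes_in_class_def)
  have three: "enat 3 \<le> davenport G" using davenport by (simp add: numeral_eq_enat)
  obtain U3 where U3: "U3 \<in> mset_atoms ZS" "3 \<le> size U3"
    using atom_of_size[OF _ three] by (metis le_refl one_le_numeral)
  have from_3: "enat n \<in> Ta H" if n: "3 \<le> n" "enat n \<le> davenport G" for n
  proof -
    have "1 \<le> n" using n(1) by simp
    then obtain u where "u \<in> mset_atoms ZS" "size u = n" using n(2) by (rule atom_of_size)
    then show ?thesis unfolding Ta using n(1) by (rule size_atom_in_Ta)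
  qed
  have two_4: "2 \<in> Ta H" if D4: "davenport G \<ge> 4"
  proof -
    have "enat 4 \<le> davenport G" using D4 by (simp add: numeral_eq_enat)
    then obtain u where u: "u \<in> mset_atoms ZS" "size u = 4"
      using atom_of_size[of 4] by (metis one_le_numeral)
    then show ?thesis unfolding Ta using two_in_Ta_of_large_atom[of u] by simp
  qed
  have two_pq: "2 \<in> Ta H"
    if C: "C \<in> carrier G" "C \<noteq> \<one>\<^bsub>G\<^esub>"
      and pq: "p \<in> primes_in_class H P \<phi> C" "q \<in> primes_in_class H P \<phi> C" "p \<noteq> q" for C p q
  proof -
    obtain k where "k \<in> carrier G" "k \<noteq> \<one>\<^bsub>G\<^esub>" "k \<noteq> inv\<^bsub>G\<^esub> C"
      using obtain_third_class[OF U3, of "inv\<^bsub>G\<^esub> C"] C(1) by auto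
    then show ?thesis
      unfolding Ta using two_in_Ta_of_two_primes[of p q C k] pq C(2) by (simp add: primes_in)
  qed
  have Ta_ge_2: "\<exists>n\<ge>2. t = enat n" if "t \<in> Ta H" for t
    using that unfolding Ta by (metis mset_Ta_cases)
  have initial: "int_interval 2 (davenport G) \<subseteq> Ta H" if "2 \<in> Ta H"
  proof
    fix t assume "t \<in> int_interval 2 (davenport G)"
    then obtain n where n: "t = enat n" "2 \<le> n" "enat n \<le> davenport G"
      unfolding int_interval_def by auto
    show "t \<in> Ta H"
    proof (cases "n = 2")
      case True
      then show ?thesis using that n by (simp add: numeral_eq_enat)
    next
      case False
      then show ?thesis using from_3[of n] n by simp
    qed
  qed
  have unbounded: "Ta H = enat ` {2..}" if D: "davenport G = \<infinity>"
  proof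
    show "Ta H \<subseteq> enat ` {2..}" using Ta_ge_2 by fastforce
    have "int_interval 2 (davenport G) = enat ` {2..}"
      unfolding int_interval_def D by auto
    then show "enat ` {2..} \<subseteq> Ta H" using initial two_4 D by simp
  qed
  have part1: "int_interval 2 (davenport G) \<subseteq> Ta H"
    if "davenport G \<ge> 4 \<or> (\<exists>C\<in>carrier G. C \<noteq> \<one>\<^bsub>G\<^esub> \<and>
           (\<exists>p\<in>primes_in_class H P \<phi> C. \<exists>q\<in>primes_in_class H P \<phi> C. p \<noteq> q))"
    using that two_4 two_pq initial by blast
  have part2: "Ta H = int_interval 2 (tame_degree H)"
    if many: "\<forall>C\<in>carrier G. infinite (primes_in_class H P \<phi> C) \<or>
         davenport G + 1 \<le> enat (card (primes_in_class H P \<phi> C))"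
  proof
    show "Ta H \<subseteq> int_interval 2 (tame_degree H)"
    proof
      fix t assume t: "t \<in> Ta H"
      then have "t \<le> tame_degree H" unfolding tame_degree_def by (rule Sup_upper)
      then show "t \<in> int_interval 2 (tame_degree H)"
        using Ta_ge_2[OF t] unfolding int_interval_def by auto
    qed
    show "int_interval 2 (tame_degree H) \<subseteq> Ta H"
    proof (cases "davenport G")
      case infinity
      then show ?thesis unfolding unbounded[OF infinity] int_interval_def by auto
    next
      case (enat D)
      have fresh: "\<exists>s\<in>P - F. divisor_class H P \<phi> s = C"
        if C: "C \<in> carrier G" and F: "finite F" "card F \<le> D" for C F
      proof (rule ccontr)
        assume "\<not> ?thesis"
        then have sub: "primes_in_class H P \<phi> C \<subseteq> F" unfolding primes_in by blast
        then have "finite (primes_in_class H P \<phi> C)" using F(1) by (rule finite_subset)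
        then have "davenport G + 1 \<le> enat (card (primes_in_class H P \<phi> C))" using many C by blast
        then have "Suc D \<le> card (primes_in_class H P \<phi> C)"
          unfolding enat one_enat_def plus_enat_simps enat_ord_simps by simp
        moreover have "card (primes_in_class H P \<phi> C) \<le> D"
          using card_mono[OF F(1) sub] F(2) by simp
        ultimately show False by simp
      qed
      obtain p where p: "p \<in> P" "divisor_class H P \<phi> p \<noteq> \<one>\<^bsub>G\<^esub>"
      proof -
        obtain p where "p \<in># U3" using mset_atomsD(2)[OF U3(1)] by blast
        moreover from this have "p \<in> P" using ZS_subset[OF mset_atomsD(1)[OF U3(1)]] by blast
        ultimately show thesis using that atom_no_identity[OF U3(1)] U3(2) by simp
      qed
      have "1 \<le> D" using three enat by simp
      then obtain q where q: "q \<in> P" "q \<noteq> p" "divisor_class H P \<phi> q = divisor_class H P \<phi> p"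
        using fresh[of "divisor_class H P \<phi> p" "{p}"] p(1) by auto
      have two: "2 \<in> Ta H"
        using two_pq[of "divisor_class H P \<phi> p" p q] p q by (simp add: primes_in)
      show ?thesis
      proof
        fix t assume "t \<in> int_interval 2 (tame_degree H)"
        then obtain n where n: "t = enat n" "2 \<le> n" "enat n \<le> tame_degree H"
          unfolding int_interval_def by auto
        show "t \<in> Ta H"
        proof (cases "n \<le> D")
          case True
          then have "t \<in> int_interval 2 (davenport G)" using n enat unfolding int_interval_def by simp
          then show ?thesis using initial[OF two] by blast
        next
          case False
          have "\<exists>s\<in>Ta H. enat n \<le> s"
          proof (rule ccontr)
            assume *: "\<not> ?thesis"
            obtain m where m: "n = Suc m" using n(2) by (cases n) auto
            have "tame_degree H \<le> enat m"
              unfolding tame_degree_def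
            proof (rule Sup_least)
              fix s assume s: "s \<in> Ta H"
              then have "\<not> enat n \<le> s" using * by blast
              then show "s \<le> enat m" using m by (metis Suc_ile_eq not_le)
            qed
            with n(3) have "enat n \<le> enat m" by (rule order_trans)
            then show False using m by simp
          qed
          then obtain a u where au: "a \<in> ZS" "u \<in> mset_atoms ZS" "enat n \<le> mset_tame ZS a u"
            unfolding Ta mset_Ta_def by blast
          have "enat n \<in> mset_Ta ZS"
          proof (rule Ta_above_davenport[OF _ _ fresh au])
            show "size v \<le> D" if "v \<in> mset_atoms ZS" for v
              using size_atom_le_davenport[OF that] enat by simp
            show "D < n" using False by simp
          qed
          then show ?thesis unfolding Ta n(1) .
        qed
      qed
    qed
  qed
  have part3: "Ta H = enat ` {2..}" if "infinite (carrier G)"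
    using unbounded davenport_infinite[OF that] by blast
  show ?thesis
  proof (intro conjI impI)
    show "Ta (zero_sum_monoid (integer_mod_group 3)) = {3}" by (rule Ta_C3)
    show "Ta (zero_sum_monoid (integer_mod_group 2 \<times>\<times> integer_mod_group 2)) = {3}"
      by (rule Ta_C2_C2)
  next
    assume "finite (carrier G) \<and> (davenport G \<ge> 4 \<or> (\<exists>C\<in>carrier G. C \<noteq> \<one>\<^bsub>G\<^esub> \<and>
      (\<exists>p\<in>primes_in_class H P \<phi> C. \<exists>q\<in>primes_in_class H P \<phi> C. p \<noteq> q)))"
    then show "int_interval 2 (davenport G) \<subseteq> Ta H" by (intro part1) (rule conjunct2)
  next
    assume "\<forall>C\<in>carrier G. infinite (primes_in_class H P \<phi> C) \<or>
      davenport G + 1 \<le> enat (card (primes_in_class H P \<phi> C))"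
    then show "Ta H = int_interval 2 (tame_degree H)" by (rule part2)
  next
    assume "infinite (carrier G)"
    then show "Ta H = enat ` {2..}" by (rule part3)
  qed
qed

end
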